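(* Let $N\ge3$, let $e_i,f_i,h_i$ ($1\le i\le N-1$) be the Chevalley generators of $sl(N)$, and put $e_{1N}=[e_1,[e_2,\cdots,[e_{N-2},e_{N-1}]\cdots]]$ and $\theta_i=\delta_{i1}+\delta_{i,N-1}$. The Jordanian quantization deforms the Chevalley generators as follows: in $\mathcal U(sl(N))[[\mathsf h]]$ let $$T=\mathsf he_{1N}+\sqrt{1+\mathsf h^2e_{1N}^2},\qquad T^{-1}=-\mathsf he_{1N}+\sqrt{1+\mathsf h^2e_{1N}^2},$$ $$E_i=T^{\theta_i/2}e_i,\qquad F_i=T^{-\theta_i/2}\Bigl(f_i+\tfrac{\mathsf h}{2}T[f_i,e_{1N}](h_1+\cdots+h_{N-1})\Bigr),$$ $$H_i=h_i-\tfrac{\theta_i\mathsf h}{2}\,e_{1N}T^{-1}(h_1+\cdots+h_{N-1})\qquad(i=1,\dots,N-1).$$ Then these elements satisfy, for all $i,j\in\{1,\dots,N-1\}$, $$[H_i,H_j]=0,\qquad [H_i,E_j]=a_{ij}E_j,$$ $$[H_i,F_j]=-a_{ij}F_j+\theta_iT^{-1}[F_j,T](H_1+\cdots+H_{N-1}),$$ $$[T^{-\theta_i}E_i,F_j]=\delta_{ij}\Bigl(T^{-\theta_i}H_i+\tfrac{\theta_i}{2}(T-T^{-1})(H_1+\cdots+H_{N-1})\Bigr),$$ $$[E_i,E_j]=0,\qquad [T^{\theta_i}F_i,T^{\theta_j}F_j]=0\qquad\text{if }|i-j|>1,$$ $$(\mathrm{ad}\,E_i)^{1-a_{ij}}(E_j)=0,\qquad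 (\mathrm{ad}\,T^{\theta_i}F_i)^{1-a_{ij}}(T^{\theta_j}F_j)=0\qquad\text{if }i\ne j,$$ where $(a_{ij})$ is the Cartan matrix of $sl(N)$: $a_{ii}=2$, $a_{i,i\pm1}=-1$, and $a_{ij}=0$ for $|i-j|>1$.
   Context: $sl(N)$ is taken over $\mathbb C$, with Chevalley generators $e_i=e_{i,i+1}$, $f_i=e_{i+1,i}$, $h_i=e_{ii}-e_{i+1,i+1}$ in terms of elementary matrices. The parameter $\mathsf h$ is formal; square roots and half-integer powers are binomial power series in $\mathsf h$ with constant term $1$; $[a,b]=ab-ba$ and $(\mathrm{ad}\,a)(b)=[a,b]$. *)

theory Defs
  imports
    "HOL-Analysis.Analysis"
    "HOL-Library.Poly_Mapping"
    "HOL-Computational_Algebra.Formal_Power_Series"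
begin

section \<open>Complex Lie algebras and their universal enveloping algebras\<close>

class complex_lie_algebra = ab_group_add +
  fixes cscale :: "complex \<Rightarrow> 'a \<Rightarrow> 'a"
    and bracket :: "'a \<Rightarrow> 'a \<Rightarrow> 'a"
  assumes cscale_add_right: "cscale c (x + y) = cscale c x + cscale c y"
    and cscale_add_left: "cscale (c + d) x = cscale c x + cscale d x"
    and cscale_cscale: "cscale c (cscale d x) = cscale (c * d) x"
    and cscale_one: "cscale 1 x = x"
    and bracket_add_left: "bracket (x + y) z = bracket x z + bracket y z"
    and bracket_add_right: "bracket x (y + z) = bracket x y + bracket x z"
    and bracket_cscale_left: "bracket (cscale c x) y = cscale c (bracket x y)"
    and bracket_cscale_right: "bracket x (cscale c y) = cscale c (bracket x y)"
    and bracket_self: "bracket x x = 0"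
    and jacobi: "bracket x (bracket y z) + bracket y (bracket z x) + bracket z (bracket x y) = 0"

text \<open>
  The free monoid is written additively because the convolution product of
  \<^theory>\<open>HOL-Library.Poly_Mapping\<close> requires \<^class>\<open>monoid_add\<close>; it is not commutative.
\<close>

datatype 'x free_monoid = Letters (letters: "'x list")

instantiation free_monoid :: (type) monoid_add
begin

definition zero_free_monoid :: "'x free_monoid"
  where "zero_free_monoid = Letters []"

definition plus_free_monoid :: "'x free_monoid \<Rightarrow> 'x free_monoid \<Rightarrow> 'x free_monoid"
  where "plus_free_monoid v w = Letters (letters v @ letters w)"

instance
  by standard (auto simp: zero_free_monoid_def plus_free_monoid_def)

end

lemma free_monoid_add_eq_0_iff: "0 = v + w \<longleftrightarrow> v = 0 \<and> w = (0 :: 'x free_monoid)"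
  by (cases v; cases w) (auto simp: zero_free_monoid_def plus_free_monoid_def)

lemma Letters_neq_0: "Letters [x] \<noteq> 0"
  by (simp add: zero_free_monoid_def)

type_synonym 'x free_algebra = "'x free_monoid \<Rightarrow>\<^sub>0 complex"

definition free_const :: "complex \<Rightarrow> 'x free_algebra"
  where "free_const c = Poly_Mapping.single 0 c"

definition free_gen :: "'x \<Rightarrow> 'x free_algebra"
  where "free_gen x = Poly_Mapping.single (Letters [x]) 1"

text \<open>
  The two-sided ideal whose quotient is the universal enveloping algebra.  The generators are
  all elements of the Lie algebra, so dividing by \<open>add_gen\<close> and \<open>cscale_gen\<close> gives the tensor
  algebra of the underlying vector space, and \<open>bracket_gen\<close> imposes $xy - yx = [x,y]$.
\<close>

inductive_set uea_ideal :: "'g::complex_lie_algebra free_algebra set" where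
  add_gen: "free_gen (x + y) - free_gen x - free_gen y \<in> uea_ideal"
| cscale_gen: "free_gen (cscale c x) - free_const c * free_gen x \<in> uea_ideal"
| bracket_gen:
    "free_gen x * free_gen y - free_gen y * free_gen x - free_gen (bracket x y) \<in> uea_ideal"
| zero: "0 \<in> uea_ideal"
| add: "a \<in> uea_ideal \<Longrightarrow> b \<in> uea_ideal \<Longrightarrow> a + b \<in> uea_ideal"
| mult_left: "a \<in> uea_ideal \<Longrightarrow> r * a \<in> uea_ideal"
| mult_right: "a \<in> uea_ideal \<Longrightarrow> a * r \<in> uea_ideal"

lemma uea_ideal_uminus: "- a \<in> uea_ideal" if "a \<in> uea_ideal"
  using uea_ideal.mult_left[OF that, of "- 1"] by simp

lemma uea_ideal_diff: "a - b \<in> uea_ideal" if "a \<in> uea_ideal" "b \<in> uea_ideal"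
  using uea_ideal.add[OF that(1) uea_ideal_uminus[OF that(2)]] by simp

text \<open>The ideal lies in the augmentation ideal and hence is proper.\<close>

lemma lookup_mult_0:
  fixes a b :: "'x free_algebra"
  shows "Poly_Mapping.lookup (a * b) 0 = Poly_Mapping.lookup a 0 * Poly_Mapping.lookup b 0"
proof -
  let ?a = "Poly_Mapping.lookup a" and ?b = "Poly_Mapping.lookup b"
  have "Sum_any (\<lambda>q. ?b q when 0 = l + q) = (?b 0 when l = 0)" for l
  proof -
    have "(\<lambda>q. ?b q when 0 = l + q) = (\<lambda>q. (?b 0 when l = 0) when q = 0)"
      by (auto simp: fun_eq_iff free_monoid_add_eq_0_iff when_def)
    then show ?thesis
      by (simp only:) simp
  qed
  then have "Poly_Mapping.lookup (a * b) 0 = Sum_any (\<lambda>l. ?a l * (?b 0 when l = 0))"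
    by (simp add: lookup_mult)
  also have "\<dots> = Sum_any (\<lambda>l :: 'x free_monoid. ?a 0 * ?b 0 when l = 0)"
    by (rule Sum_any.cong) (simp add: when_def)
  finally show ?thesis
    by simp
qed

lemma lookup_uea_ideal_0: "Poly_Mapping.lookup a 0 = 0" if "a \<in> uea_ideal"
  using that
  by induction
    (simp_all add: lookup_mult_0 lookup_add lookup_minus free_gen_def lookup_single
      zero_free_monoid_def[symmetric] Letters_neq_0)

lemma one_notin_uea_ideal: "(1 :: 'g::complex_lie_algebra free_algebra) \<notin> uea_ideal"
  using lookup_uea_ideal_0[of "1 :: 'g free_algebra"] by auto

definition uea_rel :: "'g::complex_lie_algebra free_algebra \<Rightarrow> 'g free_algebra \<Rightarrow> bool"
  where "uea_rel a b \<longleftrightarrow> a - b \<in> uea_ideal"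

lemma equivp_uea_rel: "equivp (uea_rel :: 'g::complex_lie_algebra free_algebra \<Rightarrow> _)"
proof (rule equivpI)
  show "reflp (uea_rel :: 'g free_algebra \<Rightarrow> _)"
    by (simp add: reflp_def uea_rel_def uea_ideal.zero)
  show "symp (uea_rel :: 'g free_algebra \<Rightarrow> _)"
    by (metis minus_diff_eq sympI uea_ideal_uminus uea_rel_def)
  show "transp (uea_rel :: 'g free_algebra \<Rightarrow> _)"
  proof (rule transpI)
    fix a b c :: "'g free_algebra"
    assume "uea_rel a b" "uea_rel b c"
    then have "(a - b) + (b - c) \<in> uea_ideal"
      unfolding uea_rel_def by (rule uea_ideal.add)
    then show "uea_rel a c"
      by (simp add: uea_rel_def)
  qed
qed

quotient_type (overloaded) 'g uea = "'g::complex_lie_algebra free_algebra" / uea_rel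
  by (rule equivp_uea_rel)

instantiation uea :: (complex_lie_algebra) ring_1
begin

lift_definition zero_uea :: "'a uea" is 0 .

lift_definition one_uea :: "'a uea" is 1 .

lift_definition plus_uea :: "'a uea \<Rightarrow> 'a uea \<Rightarrow> 'a uea" is "(+)"
  unfolding uea_rel_def by (metis add_diff_add uea_ideal.add)

lift_definition uminus_uea :: "'a uea \<Rightarrow> 'a uea" is uminus
  unfolding uea_rel_def by (metis minus_diff_minus uea_ideal_uminus)

lift_definition minus_uea :: "'a uea \<Rightarrow> 'a uea \<Rightarrow> 'a uea" is "(-)"
proof -
  fix a a' b b' :: "'a free_algebra"
  assume "uea_rel a a'" "uea_rel b b'"
  then have "(a - a') - (b - b') \<in> uea_ideal"
    unfolding uea_rel_def by (rule uea_ideal_diff)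
  then show "uea_rel (a - b) (a' - b')"
    by (simp add: uea_rel_def algebra_simps)
qed

lift_definition times_uea :: "'a uea \<Rightarrow> 'a uea \<Rightarrow> 'a uea" is "(*)"
proof -
  fix a a' b b' :: "'a free_algebra"
  assume "uea_rel a a'" "uea_rel b b'"
  then have "(a - a') * b + a' * (b - b') \<in> uea_ideal"
    unfolding uea_rel_def by (intro uea_ideal.intros)
  then show "uea_rel (a * b) (a' * b')"
    by (simp add: uea_rel_def algebra_simps)
qed

instance
proof
  show "(0 :: 'a uea) \<noteq> 1"
  proof transfer
    show "\<not> uea_rel 0 (1 :: 'a free_algebra)"
    proof
      assume "uea_rel 0 (1 :: 'a free_algebra)"
      then have "- (0 - 1) \<in> (uea_ideal :: 'a free_algebra set)"
        unfolding uea_rel_def by (rule uea_ideal_uminus)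
      then show False
        by (simp add: one_notin_uea_ideal)
    qed
  qed
qed (transfer; simp add: uea_rel_def algebra_simps uea_ideal.zero)+

end

lift_definition uea_const :: "complex \<Rightarrow> 'g::complex_lie_algebra uea" is free_const .

lift_definition uea_incl :: "'g::complex_lie_algebra \<Rightarrow> 'g uea" is free_gen .

lemma uea_const_add: "uea_const (c + d) = uea_const c + uea_const d"
  by transfer (simp add: free_const_def single_add uea_rel_def uea_ideal.zero)

lemma uea_const_mult: "uea_const (c * d) = uea_const c * uea_const d"
  by transfer (simp add: free_const_def mult_single uea_rel_def uea_ideal.zero)

lemma uea_const_0: "uea_const 0 = 0"
  by transfer (simp add: free_const_def uea_rel_def uea_ideal.zero)

lemma uea_const_1: "uea_const 1 = 1"
  by transfer (simp add: free_const_def uea_rel_def uea_ideal.zero)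

lemma free_const_commute: "free_const c * a = a * free_const c"
proof (induction a rule: update_induct)
  case (update f k v)
  have "Poly_Mapping.update k v f = f + Poly_Mapping.single k v"
    using update.hyps
    by (intro poly_mapping_eqI)
      (auto simp: lookup_update lookup_add lookup_single when_def in_keys_iff)
  then show ?case
    using update.IH by (simp add: free_const_def mult_single algebra_simps)
qed simp

lemma uea_const_commute: "uea_const c * a = a * uea_const c"
  by transfer (simp add: free_const_commute uea_rel_def uea_ideal.zero)

lemma uea_const_left_commute: "a * (uea_const c * b) = uea_const c * (a * b)"
  by (metis mult.assoc uea_const_commute)

lemma uea_incl_add: "uea_incl (x + y) = uea_incl x + uea_incl y"
  by transfer (use uea_ideal.add_gen in \<open>simp add: uea_rel_def diff_diff_eq\<close>)

lemma uea_incl_cscale: "uea_incl (cscale c x) = uea_const c * uea_incl x"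
  by transfer (simp add: uea_rel_def uea_ideal.cscale_gen)

definition commutator :: "'a::ring \<Rightarrow> 'a \<Rightarrow> 'a"
  where "commutator a b = a * b - b * a"

lemma uea_incl_bracket: "uea_incl (bracket x y) = commutator (uea_incl x) (uea_incl y)"
  unfolding commutator_def
proof (rule sym, transfer)
  show "uea_rel (free_gen x * free_gen y - free_gen y * free_gen x) (free_gen (bracket x y))"
    for x y :: 'a
    unfolding uea_rel_def by (rule uea_ideal.bracket_gen)
qed


section \<open>The Lie algebra of traceless matrices\<close>

typedef (overloaded) 'n sl = "{A :: complex^'n::finite^'n. trace A = 0}"
  morphisms matrix_of_sl sl_of_matrix
  by (rule exI[of _ 0]) (simp add: trace_def)

setup_lifting type_definition_sl

instantiation sl :: (finite) complex_lie_algebra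
begin

lift_definition zero_sl :: "'a sl" is 0
  by (simp add: trace_def)

lift_definition plus_sl :: "'a sl \<Rightarrow> 'a sl \<Rightarrow> 'a sl" is "(+)"
  by (simp add: trace_add)

lift_definition uminus_sl :: "'a sl \<Rightarrow> 'a sl" is uminus
  by (simp add: trace_def sum_negf)

lift_definition minus_sl :: "'a sl \<Rightarrow> 'a sl \<Rightarrow> 'a sl" is "(-)"
  by (simp add: trace_sub)

lift_definition cscale_sl :: "complex \<Rightarrow> 'a sl \<Rightarrow> 'a sl" is "\<lambda>c A. \<chi> a b. c * A $ a $ b"
  by (simp add: trace_def flip: sum_distrib_left)

lift_definition bracket_sl :: "'a sl \<Rightarrow> 'a sl \<Rightarrow> 'a sl" is "\<lambda>A B. A ** B - B ** A"
  by (simp add: trace_sub) (rule trace_mul_sym)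

instance
proof
  fix x y z :: "'a sl" and c d :: complex
  have left: "(A - B) ** C = A ** C - B ** C" for A B C :: "complex^'a^'a"
    by (simp add: vec_eq_iff matrix_matrix_mult_def sum_subtractf left_diff_distrib)
  have right: "C ** (A - B) = C ** A - C ** B" for A B C :: "complex^'a^'a"
    by (simp add: vec_eq_iff matrix_matrix_mult_def sum_subtractf right_diff_distrib)
  have add_left: "(A + B) ** C = A ** C + B ** C" for A B C :: "complex^'a^'a"
    by (simp add: vec_eq_iff matrix_matrix_mult_def sum.distrib distrib_right)
  have scale_left: "(\<chi> a b. k * A $ a $ b) ** B = (\<chi> a b. k * (A ** B) $ a $ b)"
    for k and A B :: "complex^'a^'a"
    by (simp add: vec_eq_iff matrix_matrix_mult_def sum_distrib_left mult.assoc)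
  have scale_right: "A ** (\<chi> a b. k * B $ a $ b) = (\<chi> a b. k * (A ** B) $ a $ b)"
    for k and A B :: "complex^'a^'a"
    by (simp add: vec_eq_iff matrix_matrix_mult_def sum_distrib_left mult.left_commute)
  have cyclic: "p - q - (r - s) + (r - t - (u - q)) + (u - s - (p - t)) = 0"
    for p q r s t u :: "complex^'a^'a"
    by (simp add: algebra_simps)
  show "x + y + z = x + (y + z)" "x + y = y + x" "0 + x = x" "- x + x = 0" "x - y = x + - y"
    by (transfer; simp)+
  show "cscale c (x + y) = cscale c x + cscale c y" "cscale (c + d) x = cscale c x + cscale d x"
    "cscale c (cscale d x) = cscale (c * d) x" "cscale 1 x = x"
    by (transfer; simp add: vec_eq_iff algebra_simps)+
  show "bracket (x + y) z = bracket x z + bracket y z"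
    "bracket x (y + z) = bracket x y + bracket x z"
    by (transfer, simp only: add_left matrix_add_ldistrib add_diff_add)+
  show "bracket (cscale c x) y = cscale c (bracket x y)"
    "bracket x (cscale c y) = cscale c (bracket x y)"
    by (transfer, simp only: scale_left scale_right, simp add: vec_eq_iff right_diff_distrib)+
  show "bracket x x = 0"
    by transfer simp
  show "bracket x (bracket y z) + bracket y (bracket z x) + bracket z (bracket x y) = 0"
    by transfer (simp only: left right matrix_mul_assoc cyclic)
qed

end

text \<open>Matrix positions are numbered from \<open>1\<close> along the order of the index type.\<close>

definition idx :: "nat \<Rightarrow> 'n::{finite,linorder}"
  where "idx k = sorted_list_of_set (UNIV :: 'n set) ! (k - 1)"

definition elem_matrix :: "nat \<Rightarrow> nat \<Rightarrow> complex^'n::{finite,linorder}^'n::{finite,linorder}"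
  where "elem_matrix i j = (\<chi> a b. if a = idx i \<and> b = idx j then 1 else 0)"

lemma bij_betw_idx: "bij_betw idx {1..CARD('n)} (UNIV :: 'n::{finite,linorder} set)"
proof -
  let ?xs = "sorted_list_of_set (UNIV :: 'n set)"
  have "bij_betw (\<lambda>k. k - 1) {1..CARD('n)} {..<CARD('n)}"
    by (rule bij_betwI[where g = Suc]) auto
  moreover have "bij_betw ((!) ?xs) {..<CARD('n)} UNIV"
    by (rule bij_betw_nth) auto
  ultimately have "bij_betw ((!) ?xs \<circ> (\<lambda>k. k - 1)) {1..CARD('n)} UNIV"
    by (rule bij_betw_trans)
  moreover have "(!) ?xs \<circ> (\<lambda>k. k - 1) = idx"
    by (simp add: fun_eq_iff idx_def)
  ultimately show ?thesis
    by simp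
qed

lemma trace_elem_matrix:
  assumes "i \<in> {1..CARD('n)}" "j \<in> {1..CARD('n)}"
  shows "trace (elem_matrix i j :: complex^'n::{finite,linorder}^'n::{finite,linorder}) =
    (if i = j then 1 else 0)"
proof -
  show ?thesis
  proof (cases "i = j")
    case True
    then show ?thesis
      by (simp add: trace_def elem_matrix_def)
  next
    case False
    then have "(idx i :: 'n) \<noteq> idx j"
      using assms bij_betw_idx[where 'n = 'n] by (meson bij_betw_imp_inj_on inj_on_contraD)
    then show ?thesis
      using False by (auto simp: trace_def elem_matrix_def intro!: sum.neutral)
  qed
qed

text \<open>
  The indices of the generators range over \<open>1 \<le> i < CARD('n)\<close>; outside this range the matrices
  need not be traceless and \<^const>\<open>sl_of_matrix\<close> is unspecified.
\<close>

definition chev_e :: "nat \<Rightarrow> 'n::{finite,linorder} sl uea"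
  where "chev_e i = uea_incl (sl_of_matrix (elem_matrix i (i + 1)))"

definition chev_f :: "nat \<Rightarrow> 'n::{finite,linorder} sl uea"
  where "chev_f i = uea_incl (sl_of_matrix (elem_matrix (i + 1) i))"

definition chev_h :: "nat \<Rightarrow> 'n::{finite,linorder} sl uea"
  where "chev_h i = uea_incl (sl_of_matrix (elem_matrix i i - elem_matrix (i + 1) (i + 1)))"

lemma chev_traceless:
  assumes "1 \<le> i" "i < CARD('n::{finite,linorder})"
  shows "elem_matrix i (i + 1) \<in> range (matrix_of_sl :: 'n sl \<Rightarrow> _)"
    and "elem_matrix (i + 1) i \<in> range (matrix_of_sl :: 'n sl \<Rightarrow> _)"
    and "elem_matrix i i - elem_matrix (i + 1) (i + 1) \<in> range (matrix_of_sl :: 'n sl \<Rightarrow> _)"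
  using assms by (simp_all add: type_definition.Rep_range[OF type_definition_sl]
    trace_sub trace_elem_matrix)

definition e1N :: "'n::{finite,linorder} sl uea"
  where "e1N = foldr (\<lambda>i. commutator (chev_e i)) [1..<CARD('n) - 1] (chev_e (CARD('n) - 1))"

definition theta :: "nat \<Rightarrow> nat \<Rightarrow> nat"
  where "theta N i = (if i = 1 then 1 else 0) + (if i = N - 1 then 1 else 0)"

definition cartan :: "nat \<Rightarrow> nat \<Rightarrow> int"
  where "cartan i j = (if i = j then 2 else if i = j + 1 \<or> j = i + 1 then - 1 else 0)"


section \<open>Binomial power series\<close>

abbreviation cst :: "complex \<Rightarrow> 'g::complex_lie_algebra uea fps"
  where "cst c \<equiv> fps_const (uea_const c)"

text \<open>
  The power \<open>A\<^sup>c\<close> is the binomial series $\sum_k \binom{c}{k} (A-1)^k$; it is meaningful only for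
  series with constant term \<open>1\<close>.
\<close>

definition bin_power :: "'g::complex_lie_algebra uea fps \<Rightarrow> complex \<Rightarrow> 'g uea fps"
  where "bin_power A c = fps_compose (Abs_fps (\<lambda>k. uea_const (c gchoose k))) (A - 1)"

lemma bin_power_nth:
  "fps_nth (bin_power A c) n = (\<Sum>k = 0..n. uea_const (c gchoose k) * fps_nth ((A - 1) ^ k) n)"
  by (simp add: bin_power_def fps_compose_nth)

lemma bin_power_1: "bin_power A 1 = A" if "fps_nth A 0 = 1"
proof (rule fps_ext)
  fix n
  have *: "(1 :: complex) gchoose k = (if k \<le> 1 then 1 else 0)" for k
  proof (cases "k \<le> 1")
    case True
    then show ?thesis
      by (auto simp: le_Suc_eq)
  next
    case False
    then have "1 choose k = 0"
      by (intro binomial_eq_0) simp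
    then have "(1 :: complex) gchoose k = 0"
      by (metis binomial_gbinomial of_nat_0 of_nat_1)
    then show ?thesis
      using False by simp
  qed
  have "uea_const (1 gchoose k) * fps_nth ((A - 1) ^ k) n =
      (if k = 0 then fps_nth 1 n else 0) + (if k = 1 then fps_nth (A - 1) n else 0)" for k
    unfolding * by (cases k) (auto simp: uea_const_0 uea_const_1)
  then have "fps_nth (bin_power A 1) n = fps_nth 1 n + (if 1 \<le> n then fps_nth (A - 1) n else 0)"
    by (simp only: bin_power_nth sum.distrib sum.delta finite_atLeastAtMost) simp
  also have "\<dots> = fps_nth A n"
    using that by (cases n) simp_all
  finally show "fps_nth (bin_power A 1) n = fps_nth A n" .
qed

lemma bin_power_add:
  fixes A :: "'g::complex_lie_algebra uea fps"
  assumes "fps_nth A 0 = 1"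
  shows "bin_power A (c + d) = bin_power A c * bin_power A d"
proof (rule fps_ext)
  fix n
  let ?u = "A - 1" and ?c = "\<lambda>k. uea_const (c gchoose k)" and ?d = "\<lambda>k. uea_const (d gchoose k)"
  have zero: "fps_nth (?u ^ k) m = 0" if "m < k" for k m
    using startsby_zero_power_prefix[of ?u k] that assms by simp
  have assoc: "?c k * p * (?d l * q) = ?c k * ?d l * (p * q)" for k l and p q :: "'g uea"
    by (metis mult.assoc uea_const_commute)
  have nth: "fps_nth (bin_power A c') m =
      (\<Sum>k\<le>n. uea_const (c' gchoose k) * fps_nth (?u ^ k) m)" if "m \<le> n" for c' m
    unfolding bin_power_nth using that zero
    by (intro sum.mono_neutral_left) auto
  have "fps_nth (bin_power A c * bin_power A d) n =
      (\<Sum>m = 0..n. (\<Sum>k\<le>n. ?c k * fps_nth (?u ^ k) m) * (\<Sum>l\<le>n. ?d l * fps_nth (?u ^ l) (n - m)))"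
    by (simp add: fps_mult_nth nth)
  also have "\<dots> = (\<Sum>m = 0..n. \<Sum>k\<le>n. \<Sum>l\<le>n.
      ?c k * ?d l * (fps_nth (?u ^ k) m * fps_nth (?u ^ l) (n - m)))"
    by (simp add: sum_product assoc)
  also have "\<dots> = (\<Sum>k\<le>n. \<Sum>m = 0..n. \<Sum>l\<le>n.
      ?c k * ?d l * (fps_nth (?u ^ k) m * fps_nth (?u ^ l) (n - m)))"
    by (rule sum.swap)
  also have "\<dots> = (\<Sum>k\<le>n. \<Sum>l\<le>n. \<Sum>m = 0..n.
      ?c k * ?d l * (fps_nth (?u ^ k) m * fps_nth (?u ^ l) (n - m)))"
    by (intro sum.cong refl sum.swap)
  also have "\<dots> = (\<Sum>k\<le>n. \<Sum>l\<le>n. ?c k * ?d l * fps_nth (?u ^ (k + l)) n)"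
    by (simp add: power_add fps_mult_nth sum_distrib_left)
  also have "\<dots> = (\<Sum>(k, l)\<in>{..n} \<times> {..n}. ?c k * ?d l * fps_nth (?u ^ (k + l)) n)"
    by (rule sum.cartesian_product)
  also have "\<dots> = (\<Sum>(k, l)\<in>{(k, l). k + l \<le> n}. ?c k * ?d l * fps_nth (?u ^ (k + l)) n)"
    using zero by (intro sum.mono_neutral_right) (auto, metis mult_zero_right not_le)
  also have "\<dots> = (\<Sum>p\<le>n. \<Sum>k\<le>p. ?c k * ?d (p - k) * fps_nth (?u ^ p) n)"
    by (simp add: sum.triangle_reindex_eq)
  also have "\<dots> = (\<Sum>p\<le>n. uea_const ((c + d) gchoose p) * fps_nth (?u ^ p) n)"
  proof -
    have "uea_const (sum f S) = (\<Sum>k\<in>S. uea_const (f k) :: 'g uea)" for f and S :: "nat set"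
      by (induction S rule: infinite_finite_induct) (simp_all add: uea_const_0 uea_const_add)
    then have "(\<Sum>k\<le>p. ?c k * ?d (p - k)) = (uea_const ((c + d) gchoose p) :: 'g uea)" for p
      unfolding gbinomial_Vandermonde[symmetric] by (simp add: uea_const_mult atLeast0AtMost)
    then show ?thesis
      by (simp flip: sum_distrib_right)
  qed
  also have "\<dots> = fps_nth (bin_power A (c + d)) n"
    by (simp add: nth)
  finally show "fps_nth (bin_power A (c + d)) n = fps_nth (bin_power A c * bin_power A d) n"
    by simp
qed


lemma bin_power_commute: "x * bin_power A c = bin_power A c * x"
  if "x * A = A * x" "fps_nth A 0 = 1"
proof (rule fps_ext)
  fix n
  let ?u = "A - 1" and ?c = "\<lambda>k. uea_const (c gchoose k)"
  have "fps_nth (?u ^ k) m = 0" if "m < k" for k m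
    using startsby_zero_power_prefix[of ?u k] that \<open>fps_nth A 0 = 1\<close> by simp
  then have nth: "fps_nth (bin_power A c) m = (\<Sum>k\<le>n. ?c k * fps_nth (?u ^ k) m)"
    if "m \<le> n" for m
    unfolding bin_power_nth using that by (intro sum.mono_neutral_left) auto
  have comm: "x * ?u ^ k = ?u ^ k * x" for k
    using that(1) by (intro power_commuting_commutes[symmetric]) (simp add: algebra_simps)
  have "fps_nth (x * bin_power A c) n =
      (\<Sum>m = 0..n. \<Sum>k\<le>n. ?c k * (fps_nth x m * fps_nth (?u ^ k) (n - m)))"
    by (simp add: fps_mult_nth nth sum_distrib_left uea_const_left_commute)
  also have "\<dots> = (\<Sum>k\<le>n. ?c k * fps_nth (x * ?u ^ k) n)"
    by (subst sum.swap) (simp add: fps_mult_nth sum_distrib_left)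
  also have "\<dots> = (\<Sum>k\<le>n. ?c k * fps_nth (?u ^ k * x) n)"
    by (simp add: comm)
  also have "\<dots> = (\<Sum>m = 0..n. \<Sum>k\<le>n. ?c k * fps_nth (?u ^ k) m * fps_nth x (n - m))"
    by (subst sum.swap) (simp add: fps_mult_nth sum_distrib_left mult.assoc)
  also have "\<dots> = fps_nth (bin_power A c * x) n"
    by (simp add: fps_mult_nth nth sum_distrib_right)
  finally show "fps_nth (x * bin_power A c) n = fps_nth (bin_power A c * x) n" .
qed

section \<open>The Jordanian deformation of the Chevalley generators\<close>

text \<open>The deformation parameter is \<^const>\<open>fps_X\<close>.\<close>

abbreviation hh :: "'g::complex_lie_algebra uea fps"
  where "hh \<equiv> fps_X"

definition jsqrt :: "'n::{finite,linorder} sl uea fps"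
  where "jsqrt = bin_power (1 + hh ^ 2 * fps_const e1N ^ 2) (1 / 2)"

definition jT :: "'n::{finite,linorder} sl uea fps"
  where "jT = hh * fps_const e1N + jsqrt"

definition jTinv :: "'n::{finite,linorder} sl uea fps"
  where "jTinv = - (hh * fps_const e1N) + jsqrt"

definition h_sum :: "'n::{finite,linorder} sl uea"
  where "h_sum = (\<Sum>i = 1..CARD('n) - 1. chev_h i)"

definition jE :: "nat \<Rightarrow> 'n::{finite,linorder} sl uea fps"
  where "jE i = bin_power jT (of_nat (theta CARD('n) i) / 2) * fps_const (chev_e i)"

definition jF :: "nat \<Rightarrow> 'n::{finite,linorder} sl uea fps"
  where "jF i = bin_power jT (- of_nat (theta CARD('n) i) / 2) *
    (fps_const (chev_f i) +
      cst (1 / 2) * hh * jT * fps_const (commutator (chev_f i) e1N) * fps_const h_sum)"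

definition jH :: "nat \<Rightarrow> 'n::{finite,linorder} sl uea fps"
  where "jH i = fps_const (chev_h i) -
    cst (of_nat (theta CARD('n) i) / 2) * hh * fps_const e1N * jTinv * fps_const h_sum"

definition jH_sum :: "'n::{finite,linorder} sl uea fps"
  where "jH_sum = (\<Sum>i = 1..CARD('n) - 1. jH i)"

lemma jT_nth_0: "fps_nth jT 0 = 1"
  by (simp add: jT_def jsqrt_def bin_power_nth uea_const_1)

lemma jsqrt_square:
  "jsqrt * jsqrt = (1 + hh ^ 2 * fps_const e1N ^ 2 :: 'n::{finite,linorder} sl uea fps)"
proof -
  let ?A = "1 + hh ^ 2 * fps_const e1N ^ 2 :: 'n sl uea fps"
  have "fps_nth ?A 0 = 1"
    by simp
  then show ?thesis
    using bin_power_add[of ?A "1 / 2" "1 / 2"] bin_power_1[of ?A] by (simp add: jsqrt_def)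
qed

lemma jT_jTinv:
  "jT * jTinv = (1 :: 'n::{finite,linorder} sl uea fps)"
  "jTinv * jT = (1 :: 'n::{finite,linorder} sl uea fps)"
proof -
  define a where "a = (hh * fps_const e1N :: 'n sl uea fps)"
  define s where "s = (jsqrt :: 'n sl uea fps)"
  have a2: "hh ^ 2 * fps_const e1N ^ 2 = a * a"
  proof -
    let ?e = "fps_const e1N :: 'n sl uea fps"
    have "hh ^ 2 * ?e ^ 2 = hh * (hh * ?e) * ?e"
      by (simp only: power2_eq_square mult.assoc)
    also have "\<dots> = hh * (?e * hh) * ?e"
      by (simp only: fps_mult_fps_X_commute)
    also have "\<dots> = a * a"
      by (simp only: a_def mult.assoc)
    finally show ?thesis .
  qed
  have s2: "s * s = 1 + a * a"
    by (simp only: s_def jsqrt_square a2)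
  have comm: "a * s = s * a"
    unfolding s_def jsqrt_def a2
    by (rule bin_power_commute) (simp_all only: distrib_left distrib_right mult.assoc,
      simp_all add: a_def)
  have "(a + s) * (s - a) = 1" "(s - a) * (a + s) = 1"
    by (simp_all add: distrib_left distrib_right left_diff_distrib right_diff_distrib s2 comm)
  moreover have "jT = a + s" "jTinv = s - a"
    by (simp_all add: jT_def jTinv_def a_def s_def)
  ultimately show "jT * jTinv = (1 :: 'n sl uea fps)" "jTinv * jT = (1 :: 'n sl uea fps)"
    by simp_all
qed

end

(*
  Put e = e1N and h = h_sum.  Evaluating complex power series p(X) at X = hh * e is a ring
  homomorphism, and T, T^(-1) and all powers T^c are values of series; bracketing with an element
  x of sl(N) acts on these values by a derivation as soon as [x, e] commutes with e or is a
  multiple of e.  For f_i with g_i = [f_i, e], the elements phi_i = f_i + (hh/2) T g_i h satisfy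
  [phi_i, p] = hh T sqrt(1 + X^2) p' g_i.  The relations thereby become identities between the
  coefficient series of ordered monomials, which follow from T = X + sqrt(1 + X^2).
  For the Serre relations among the F's the generators f_i with theta_i = 0 act on the elements
  x + (hh/2) T [x, e] h just as they act on x.  Two generators with theta = 1 are adjacent only for
  N = 3; there w = [f_1, f_2] satisfies [w, e] = h, and the double bracket is computed directly.
*)
theory Submission
  imports Defs
begin

section \<open>The power series of the square root and of \<open>T\<close>\<close>

text \<open>The enveloping algebra is not commutative, so a decision procedure for polynomial
  identities cannot be applied to the relations directly. Every coefficient is therefore kept as
  \<open>J p\<close> with \<open>p\<close> in the commutative ring of complex series: directed
  rewriting puts the noncommuting factors into a fixed order, and \<open>algebra\<close> settles
  what remains in \<open>complex fps\<close>. The factor T/2 in F_i is explained by [h, p] = 2 X p':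
  the term with h adds X T p' to p', and 1 + X T = T sqrt(1 + X^2). The square root cancels against
  the derivative of a power of T, so that [phi_i, T^c] = c hh T T^c g_i without any root. The
  exponents of T are such that these brackets absorb the terms left by moving h past the other
  factors. The case N = 3 is exceptional because w = [f_1, f_2] is a multiple of the lowest root
  vector: [w, e] = h does not commute with e, so bracketing w with p involves p'' as well, and
  [g_1, g_2] does not vanish.\<close>

definition sig :: "complex fps"
  where "sig = fps_binomial (1 / 2) oo fps_X ^ 2"

definition tau :: "complex fps"
  where "tau = fps_X + sig"

text \<open>A composite with \<open>fps_binomial\<close> is exactly the shape that
  \<open>bin_power_eval_series\<close> produces from \<open>bin_power jT c\<close>; the same reason
  lies behind the form of \<open>sig\<close>.\<close>

definition tau_power :: "complex \<Rightarrow> complex fps"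
  where "tau_power c = fps_binomial c oo (tau - 1)"

lemma sig_nth_0 [simp]: "fps_nth sig 0 = 1"
  by (simp add: sig_def)

lemma tau_nth_0 [simp]: "fps_nth tau 0 = 1"
  by (simp add: tau_def)

lemma sig_mult_sig: "sig * sig = 1 + fps_X ^ 2"
proof -
  have "sig * sig = (fps_binomial (1 / 2) * fps_binomial (1 / 2)) oo fps_X ^ 2"
    unfolding sig_def by (subst fps_compose_mult_distrib) auto
  also have "fps_binomial (1 / 2) * fps_binomial (1 / 2) = (fps_binomial 1 :: complex fps)"
    by (simp flip: fps_binomial_add_mult)
  also have "\<dots> oo fps_X ^ 2 = 1 + fps_X ^ 2"
    by (simp add: fps_binomial_1 fps_compose_add_distrib)
  finally show ?thesis .
qed

lemma tau_mult_conjugate: "tau * (sig - fps_X) = 1"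
  using sig_mult_sig by (simp add: tau_def algebra_simps power2_eq_square)

lemma tau_power_add: "tau_power (c + d) = tau_power c * tau_power d"
  unfolding tau_power_def fps_binomial_add_mult by (subst fps_compose_mult_distrib) auto

lemma tau_power_0 [simp]: "tau_power 0 = 1"
  by (simp add: tau_power_def)

lemma tau_power_1 [simp]: "tau_power 1 = tau"
  by (simp add: tau_power_def fps_binomial_1 fps_compose_add_distrib)

lemma tau_power_minus_1: "tau_power (- 1) = sig - fps_X"
proof -
  have "tau * tau_power (- 1) = tau * (sig - fps_X)"
    using tau_power_add[of 1 "- 1"] tau_mult_conjugate by simp
  moreover have "tau \<noteq> 0"
    using tau_nth_0 by (metis fps_zero_nth zero_neq_one)
  ultimately show ?thesis
    by simp
qed

text \<open>With \<open>1 / sig\<close> adjoined, the ring generated by \<open>X\<close>,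
  \<open>sig\<close> and the powers of \<open>tau\<close> is closed under \<open>fps_deriv\<close>,
  with polynomial formulas for all derivatives.\<close>

definition rho :: "complex fps"
  where "rho = inverse sig"

lemma sig_mult_rho: "sig * rho = 1"
  unfolding rho_def by (rule inverse_mult_eq_1') simp

lemma fps_deriv_sig: "fps_deriv sig = fps_X * rho"
proof -
  have "fps_deriv (sig * sig) = fps_deriv (1 + fps_X ^ 2)"
    by (simp only: sig_mult_sig)
  then have "2 * (sig * fps_deriv sig) = 2 * fps_X"
    by (simp add: power2_eq_square algebra_simps)
  then have "sig * fps_deriv sig = fps_X"
    by (metis mult_cancel_left zero_neq_numeral)
  then have "(sig * rho) * fps_deriv sig = fps_X * rho"
    by (metis mult.assoc mult.commute)
  then show ?thesis
    by (simp add: sig_mult_rho)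
qed

lemma fps_deriv_tau: "fps_deriv tau = rho * tau"
  using sig_mult_rho by (simp add: tau_def fps_deriv_sig algebra_simps)

lemma fps_deriv_rho: "fps_deriv rho = - fps_X * rho ^ 3"
proof -
  have "fps_deriv (sig * rho) = 0"
    by (simp add: sig_mult_rho)
  then have "rho * (sig * fps_deriv rho + fps_X * rho * rho) = 0"
    by (simp add: fps_deriv_sig algebra_simps)
  then have "(sig * rho) * fps_deriv rho = - fps_X * rho ^ 3"
    by (simp add: algebra_simps power3_eq_cube add_eq_0_iff)
  then show ?thesis
    by (simp add: sig_mult_rho)
qed

text \<open>In effect \<open>tau_power c\<close> is exp(c arsinh X), and arsinh has derivative
  \<open>rho\<close>. The proof combines the differential equation (1 + X) b' = c b of the binomial
  series with the chain rule.\<close>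

lemma fps_deriv_tau_power: "fps_deriv (tau_power c) = fps_const c * rho * tau_power c"
proof -
  have "inverse (1 + fps_X) * (1 + fps_X) = (1 :: complex fps)"
    by (rule inverse_mult_eq_1) simp
  then have "fps_deriv (fps_binomial c) * (1 + fps_X) = fps_const c * fps_binomial c"
    by (simp add: fps_binomial_deriv fps_divide_unit mult.assoc)
  then have "(fps_deriv (fps_binomial c) * (1 + fps_X)) oo (tau - 1) =
      (fps_const c * fps_binomial c) oo (tau - 1)"
    by (simp only:)
  then have "(fps_deriv (fps_binomial c) oo (tau - 1)) * tau = fps_const c * tau_power c"
    by (simp add: fps_compose_mult_distrib fps_compose_add_distrib tau_power_def)
  moreover have "fps_deriv (tau_power c) = (fps_deriv (fps_binomial c) oo (tau - 1)) * (rho * tau)"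
    unfolding tau_power_def by (simp add: fps_compose_deriv fps_deriv_tau)
  ultimately show ?thesis
    by (simp add: mult_ac)
qed

text \<open>Both sides equal sig^2 + X sig. The left side is the factor that arises in
  \<open>phi_J\<close>.\<close>

lemma one_plus_X_mult_tau: "1 + fps_X * tau = sig * tau"
  using sig_mult_sig by (simp add: tau_def algebra_simps power2_eq_square)

section \<open>Deformed generators over an algebra of power series in one element\<close>

lemma commutator_mult_right:
  "commutator x (y * z) = commutator x y * z + y * commutator x (z :: 'r::ring)"
  by (simp add: commutator_def algebra_simps)

lemma commutator_mult_left:
  "commutator (x * y) z = x * commutator y z + commutator x z * (y :: 'r::ring)"
  by (simp add: commutator_def algebra_simps)

lemma commutator_diff_left: "commutator (x - y) z = commutator x z - commutator y (z :: 'r::ring)"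
  by (simp add: commutator_def algebra_simps)

lemma commutator_swap: "commutator x y = - commutator y (x :: 'r::ring)"
  by (simp add: commutator_def)

text \<open>Directed rules for normal ordering: \<open>x\<close> moves to the right past
  \<open>y\<close>. The second form acts inside a product associated to the right, where
  \<open>y\<close> is followed by a further factor.\<close>

lemma commutator_rewrite:
  assumes "commutator x y = (u :: 'r::ring)"
  shows "x * y = y * x + u" and "x * (y * t) = y * (x * t) + u * t"
  using assms by (simp_all add: commutator_def algebra_simps flip: mult.assoc)

lemma commute_rewrite:
  assumes "commutator x y = (0 :: 'r::ring)"
  shows "x * y = y * x" and "x * (y * t) = y * (x * t)"
  using commutator_rewrite[OF assms] by simp_all

lemma commutator_zero: "commutator x 0 = (0 :: 'r::ring)" "commutator 0 x = (0 :: 'r::ring)"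
  by (simp_all add: commutator_def)

lemma commutator_uminus: "commutator x (- y) = - commutator x (y :: 'r::ring)"
   "commutator (- x) y = - commutator x (y :: 'r::ring)"
  by (simp_all add: commutator_def)

lemma commutator_jacobi:
  "commutator x (commutator y z) = commutator (commutator x y) z + commutator y (commutator x (z :: 'r::ring))"
  by (simp add: commutator_def algebra_simps)

lemma commutator_one_right: "commutator x 1 = (0 :: 'r::ring_1)"
  by (simp add: commutator_def)

text \<open>
  \<open>J p\<close> stands for $p(\mathsf h e_{1N})$.  The deformation parameter is absorbed into the elements
  that play the role of $g = \mathsf h[f, e_{1N}]$, so that \<open>[f, J p] = J p' g\<close>.
\<close>

locale jordanian =
  fixes J :: "complex fps \<Rightarrow> 'r::ring_1" and h :: 'r
  assumes J_add: "J (p + q) = J p + J q"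
    and J_mult: "J (p * q) = J p * J q"
    and J_1: "J 1 = 1"
    and h_J: "commutator h (J p) = J (fps_const 2 * fps_X * fps_deriv p)"
begin

lemma J_0: "J 0 = 0"
  using J_add[of 0 0] by simp

lemma J_minus: "J (- p) = - J p"
  using J_add[of p "- p"] by (simp add: J_0 add_eq_0_iff)

lemma J_diff: "J (p - q) = J p - J q"
  using J_add[of p "- q"] by (simp add: J_minus)

lemma J_of_nat: "J (of_nat n) = of_nat n"
  by (induction n) (simp_all add: J_0 J_add J_1)

lemma J_of_int: "J (of_int n) = of_int n"
  by (cases n) (simp_all add: J_of_nat J_minus J_diff J_1)

lemma J_numeral: "J (numeral n) = numeral n"
  using J_of_nat[of "numeral n"] by simp

lemma J_commute: "J p * J q = J q * J p"
  by (metis J_mult mult.commute)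

definition pow :: "complex \<Rightarrow> 'r"
  where "pow c = J (tau_power c)"

text \<open>This is F_i without its power of T, with \<open>f\<close> for f_i and \<open>g\<close>
  for \<open>hh\<close> times [f_i, e]. Likewise \<open>ham\<close> is H_i with \<open>c\<close> for
  theta_i and \<open>k\<close> for h_i.\<close>

definition phi :: "'r \<Rightarrow> 'r \<Rightarrow> 'r"
  where "phi f g = f + J (fps_const (1 / 2) * tau) * g * h"

definition ham :: "complex \<Rightarrow> 'r \<Rightarrow> 'r"
  where "ham c k = k - J (fps_const (c / 2) * fps_X * (sig - fps_X)) * h"

lemma J_merge: "J p * J q = J (p * q)" "J p * (J q * x) = J (p * q) * x"
  by (simp_all add: J_mult mult.assoc)

lemma J_left_commute: "J p * (J q * x) = J q * (J p * x)"
  by (metis J_commute mult.assoc)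

section \<open>Brackets of the deformed Cartan elements with each other, with powers of T and with
  the E's\<close>

lemma ham_eq: "ham c k = k - J (fps_const c * (fps_const (1 / 2) * (fps_X * (sig - fps_X)))) * h"
proof -
  have "fps_const (c / 2) = fps_const c * fps_const (1 / 2)"
    by simp
  then show ?thesis
    by (simp only: ham_def mult.assoc)
qed

text \<open>Writing the correction in \<open>ham c k\<close> as c q h, the two mixed brackets are
  minus and plus c d X q' h, and they cancel.\<close>

lemma ham_ham:
  assumes "commutator k k' = 0" "commutator k h = 0" "commutator k' h = 0"
    and "\<And>p. commutator k (J p) = J (fps_const c * fps_X * fps_deriv p)"
    and "\<And>p. commutator k' (J p) = J (fps_const d * fps_X * fps_deriv p)"
  shows "commutator (ham c k) (ham d k') = 0"
proof -
  define q where "q = fps_const (1 / 2) * (fps_X * (sig - fps_X))"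
  note [simp] = commute_rewrite[OF assms(1)] commute_rewrite[OF assms(2)] commute_rewrite[OF assms(3)]
    commutator_rewrite[OF assms(4)] commutator_rewrite[OF assms(5)] commutator_rewrite[OF h_J]
  show ?thesis
    unfolding ham_eq q_def[symmetric] commutator_def
    by (simp add: distrib_left distrib_right left_diff_distrib right_diff_distrib mult.assoc J_merge)
      (simp add: algebra_simps)
qed

text \<open>\<open>X (sig - X)\<close> is the series of $\mathsf h e_{1N}T^{-1}$, and \<open>rho\<close> is \<open>1 / sig\<close>.\<close>

lemma X_rho_eq: "fps_X * rho * (1 - fps_X * (sig - fps_X)) = fps_X * (sig - fps_X)"
  using sig_mult_rho sig_mult_sig by algebra

text \<open>Here 1 - X (sig - X) = sig (sig - X), and sig - X is the inverse of
  \<open>tau\<close>.\<close>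

lemma tau_tau_rho_eq: "tau * tau * rho * (1 - fps_X * (sig - fps_X)) = tau"
  unfolding tau_def using sig_mult_rho sig_mult_sig by algebra

text \<open>The derivative of X (sig - X) is rho (sig - X)^2.\<close>

lemma deriv_a_Tinv_eq: "tau * sig * fps_deriv (fps_X * (sig - fps_X)) = sig - fps_X"
  unfolding tau_def by (simp add: fps_deriv_sig) (use sig_mult_rho sig_mult_sig in algebra)

text \<open>The element \<open>k\<close> contributes c X p', and the term with \<open>h\<close>
  takes away c X (sig - X) X p'. For a power of T the factor \<open>rho\<close> of p' reduces the
  difference by \<open>X_rho_eq\<close>.\<close>

lemma deriv_ham:
  assumes k: "\<And>p. commutator k (J p) = J (fps_const c * fps_X * fps_deriv p)"
  shows "commutator (ham c k) (pow b) = J (fps_const (c * b) * (fps_X * (sig - fps_X))) * pow b"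
proof -
  define P where "P = tau_power b"
  define q where "q = fps_X * (sig - fps_X)"
  have P: "fps_deriv P = fps_const b * rho * P"
    unfolding P_def by (rule fps_deriv_tau_power)
  have "commutator (ham c k) (J P) =
      commutator k (J P) - J (fps_const c * (fps_const (1 / 2) * q)) * commutator h (J P)"
    unfolding ham_eq q_def[symmetric]
    by (simp add: commutator_def algebra_simps J_commute J_left_commute)
  also have "\<dots> = J (fps_const c * fps_X * fps_deriv P -
      fps_const c * (fps_const (1 / 2) * q) * (fps_const 2 * fps_X * fps_deriv P))"
    by (simp add: k h_J J_merge J_diff)
  also have "fps_const c * fps_X * fps_deriv P -
      fps_const c * (fps_const (1 / 2) * q) * (fps_const 2 * fps_X * fps_deriv P) =
      fps_const c * fps_const b * (fps_X * rho * (1 - (fps_const (1 / 2) * fps_const 2) * q)) * P"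
    unfolding P by algebra
  also have "\<dots> = fps_const (c * b) * q * P"
    using X_rho_eq by (simp add: q_def)
  finally show ?thesis
    by (simp add: P_def q_def pow_def J_mult mult.assoc)
qed

text \<open>The exponent d/2 makes the relation exact: the bracket with the power of T is (c d / 2)
  X (sig - X), which cancels the part of \<open>ham\<close> that sees the weight d of
  \<open>x\<close> under \<open>h\<close>.\<close>

lemma ham_E:
  assumes k: "\<And>p. commutator k (J p) = J (fps_const c * fps_X * fps_deriv p)"
    and h: "commutator h x = J (fps_const d) * x" and kx: "commutator k x = J (fps_const b) * x"
    and x: "\<And>p. commutator x (J p) = 0"
  shows "commutator (ham c k) (pow (d / 2) * x) = J (fps_const b) * (pow (d / 2) * x)"
proof -
  define q where "q = fps_X * (sig - fps_X)"
  have *: "commutator (ham c k) x = J (fps_const b) * x - J (fps_const (c / 2) * q) * (J (fps_const d) * x)"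
    unfolding ham_def mult.assoc q_def[symmetric] kx[symmetric] h[symmetric]
    by (simp add: commutator_def algebra_simps commute_rewrite[OF x])
  show ?thesis
    unfolding commutator_mult_right deriv_ham[OF k] q_def[symmetric] *
    by (simp add: pow_def algebra_simps J_merge)
qed

section \<open>Brackets with the deformed lowering elements\<close>

definition raise :: "'r \<Rightarrow> 'r \<Rightarrow> bool"
  where "raise f g \<longleftrightarrow> (\<forall>p. commutator f (J p) = J (fps_deriv p) * g) \<and> (\<forall>p. commutator g (J p) = 0)"

lemma raiseD:
  assumes "raise f g"
  shows "commutator f (J p) = J (fps_deriv p) * g" "commutator g (J p) = 0"
  using assms by (auto simp: raise_def)

text \<open>To the derivative p' the term with \<open>h\<close> adds (tau / 2) (2 X p') = X tau p',
  and 1 + X tau = tau sig.\<close>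

lemma phi_J:
  assumes "raise f g"
  shows "commutator (phi f g) (J p) = J (tau * sig * fps_deriv p) * g"
proof -
  note [simp] = commutator_rewrite[OF raiseD(1)[OF assms]] commute_rewrite[OF raiseD(2)[OF assms]] commutator_rewrite[OF h_J]
  define q where "q = fps_const (1 / 2) * tau"
  have "commutator (phi f g) (J p) = J (fps_deriv p) * g + J (q * (fps_const 2 * fps_X * fps_deriv p)) * g"
    unfolding commutator_def phi_def q_def[symmetric]
    by (simp add: distrib_left distrib_right left_diff_distrib right_diff_distrib mult.assoc J_merge)
      (simp add: algebra_simps)
  also have "\<dots> = J (fps_deriv p + q * (fps_const 2 * fps_X * fps_deriv p)) * g"
    by (simp add: J_add distrib_right)
  also have "fps_deriv p + q * (fps_const 2 * fps_X * fps_deriv p) =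
      (1 + (fps_const (1 / 2) * fps_const 2) * fps_X * tau) * fps_deriv p"
    unfolding q_def by algebra
  also have "\<dots> = tau * sig * fps_deriv p"
    by (simp add: one_plus_X_mult_tau mult_ac)
  finally show ?thesis .
qed

text \<open>The factor \<open>sig\<close> of \<open>phi_J\<close> meets the \<open>rho\<close> in
  the derivative of the power and disappears.\<close>

lemma phi_pow:
  assumes "raise f g"
  shows "commutator (phi f g) (pow c) = J (fps_const c * tau) * pow c * g"
proof -
  have "tau * sig * fps_deriv (tau_power c) = fps_const c * tau * tau_power c * (sig * rho)"
    unfolding fps_deriv_tau_power by algebra
  then have "tau * sig * fps_deriv (tau_power c) = fps_const c * tau * tau_power c"
    by (simp only: sig_mult_rho mult_1_right)
  then show ?thesis
    by (simp only: phi_J[OF assms] pow_def J_mult)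
qed

text \<open>Only \<open>f\<close> has exact weight -b. The excess of (tau / 2) g h over that weight
  is (c / 2) tau (1 + X rho), which is (c / 2) tau^2 rho because 1 = sig rho.\<close>

lemma weight_phi:
  assumes k: "\<And>p. commutator k (J p) = J (fps_const c * fps_X * fps_deriv p)"
    and "commutator k f = - J (fps_const b) * f" "commutator k g = J (fps_const (c - b)) * g"
    and "commutator k h = 0"
  shows "commutator k (phi f g) =
    - J (fps_const b) * phi f g + J (fps_const (c / 2) * (tau * tau * rho)) * g * h"
proof -
  note [simp] = commutator_rewrite[OF k] commutator_rewrite[OF assms(2)] commutator_rewrite[OF assms(3)] commute_rewrite[OF assms(4)]
  define q where "q = fps_const (1 / 2) * tau"
  have deriv_q: "fps_deriv q = fps_const (1 / 2) * (rho * tau)"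
    by (simp add: q_def fps_deriv_tau)
  have "commutator k (phi f g) = - J (fps_const b) * f +
      J (fps_const c * fps_X * fps_deriv q + q * fps_const (c - b)) * (g * h)"
    unfolding commutator_def phi_def q_def[symmetric]
    by (simp add: distrib_left distrib_right left_diff_distrib right_diff_distrib mult.assoc J_merge J_add)
  also have "fps_const c * fps_X * fps_deriv q + q * fps_const (c - b) =
    fps_const c * fps_const (1 / 2) * (tau * (fps_X * rho + sig * rho)) - fps_const b * q"
    unfolding deriv_q unfolding q_def fps_const_sub[symmetric] using sig_mult_rho by algebra
  also have "fps_const c * fps_const (1 / 2) = fps_const (c / 2)"
    by simp
  also have "tau * (fps_X * rho + sig * rho) = tau * tau * rho"
    unfolding tau_def by algebra
  finally show ?thesis
    unfolding phi_def q_def[symmetric]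
    by (simp add: J_diff J_mult distrib_left distrib_right left_diff_distrib mult.assoc)
qed

text \<open>The coefficient of g h collects (c / 2) tau from the weights
  (\<open>tau_tau_rho_eq\<close>) and (c / 2) (sig - X) from the bracket of \<open>phi\<close> with
  the series in \<open>ham\<close> (\<open>deriv_a_Tinv_eq\<close>); their sum is c sig.\<close>

lemma ham_phi:
  assumes "raise f g"
    and k: "\<And>p. commutator k (J p) = J (fps_const c * fps_X * fps_deriv p)"
    and kf: "commutator k f = - J (fps_const b) * f" "commutator k g = J (fps_const (c - b)) * g"
    and kh: "commutator k h = 0"
    and hf: "commutator h f = - J (fps_const d) * f" "commutator h g = J (fps_const (2 - d)) * g"
  shows "commutator (ham c k) (phi f g) = - J (fps_const b) * phi f g
    + J (fps_const c * sig) * g * h + J (fps_const (c * d / 2) * (fps_X * (sig - fps_X))) * phi f g"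
proof -
  define a where "a = fps_X * (sig - fps_X)"
  define q where "q = fps_const (c / 2) * a"
  let ?w = "tau * tau * rho"
  have ham: "ham c k = k - J q * h"
    by (simp add: ham_def q_def a_def mult.assoc)
  \<comment> \<open>The element \<open>h\<close> is itself of the kind treated in
    \<open>weight_phi\<close>, with 2 for \<open>c\<close> and \<open>d\<close> for
    \<open>b\<close>.\<close>
  have "commutator h (phi f g) = - J (fps_const d) * phi f g + J (fps_const (2 / 2) * ?w) * g * h"
    using h_J hf by (intro weight_phi) (simp_all add: commutator_def)
  then have hphi: "commutator h (phi f g) = J ?w * g * h - J (fps_const d) * phi f g"
    by simp
  have *: "tau * sig * fps_deriv a = sig - fps_X" "?w - ?w * a = tau"
    using deriv_a_Tinv_eq tau_tau_rho_eq by (simp_all add: a_def algebra_simps)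
  have "commutator (ham c k) (phi f g) = commutator k (phi f g) -
      (J q * commutator h (phi f g) - J (tau * sig * fps_deriv q) * g * h)"
    unfolding ham commutator_diff_left commutator_mult_left commutator_swap[of "J q"] phi_J[OF assms(1)]
    by simp
  also have "\<dots> = - J (fps_const b) * phi f g + J (q * fps_const d) * phi f g
     + J (fps_const (c / 2) * ?w - q * ?w + tau * sig * fps_deriv q) * g * h"
    unfolding weight_phi[OF k kf kh] hphi
    by (simp add: algebra_simps J_add J_diff J_merge)
  also have "fps_const (c / 2) * ?w - q * ?w + tau * sig * fps_deriv q =
      fps_const (c / 2) * ((?w - ?w * a) + tau * sig * fps_deriv a)"
    by (simp add: q_def algebra_simps)
  also have "\<dots> = fps_const (c / 2) * (fps_const 2 * sig)"
    unfolding * by (simp add: tau_def numeral_fps_const)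
  also have "\<dots> = fps_const c * sig"
    by simp
  also have "q * fps_const d = fps_const (c * d / 2) * a"
    by (simp add: q_def mult_ac)
  finally show ?thesis
    by (simp add: a_def)
qed

text \<open>The power T^(-d/2) contributes minus the last term of \<open>ham_phi\<close>. The
  remaining term c sig g h is rewritten through [F, T], where \<open>J (sig - X)\<close> is T^(-1)
  and \<open>J (sig * (sig - X)) * h\<close> will be the sum of the H's by
  \<open>jH_sum_eq\<close>.\<close>

lemma ham_F:
  assumes fg: "raise f g"
    and k: "\<And>p. commutator k (J p) = J (fps_const c * fps_X * fps_deriv p)"
    and kf: "commutator k f = - J (fps_const b) * f" "commutator k g = J (fps_const (c - b)) * g"
    and kh: "commutator k h = 0"
    and hf: "commutator h f = - J (fps_const d) * f" "commutator h g = J (fps_const (2 - d)) * g"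
  shows "commutator (ham c k) (pow (- (d / 2)) * phi f g) =
    - J (fps_const b) * (pow (- (d / 2)) * phi f g) +
    J (fps_const c) * J (sig - fps_X) * commutator (pow (- (d / 2)) * phi f g) (J tau) *
      (J (sig * (sig - fps_X)) * h)"
proof -
  note [simp] = commute_rewrite[OF raiseD(2)[OF fg]]
  define P where "P = tau_power (- (d / 2))"
  define a where "a = fps_X * (sig - fps_X)"
  have "tau * sig * fps_deriv tau = tau * tau"
    unfolding fps_deriv_tau using sig_mult_rho by algebra
  moreover have "commutator (J P) (J tau) = 0"
    by (simp add: commutator_def J_commute)
  ultimately have 1: "commutator (pow (- (d / 2)) * phi f g) (J tau) = J (P * (tau * tau)) * g"
    unfolding commutator_mult_left phi_J[OF fg] pow_def P_def
    by (simp only: J_merge) simp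
  have 2: "(sig - fps_X) * (P * (tau * tau)) * (sig * (sig - fps_X)) = sig * P"
    using tau_mult_conjugate by algebra
  have "J (fps_const c) * J (sig - fps_X) * (J (P * (tau * tau)) * g) * (J (sig * (sig - fps_X)) * h) =
    J (fps_const c * ((sig - fps_X) * (P * (tau * tau)) * (sig * (sig - fps_X)))) * g * h"
    by (simp add: J_merge mult.assoc)
  then have 3: "J (fps_const c) * J (sig - fps_X) * commutator (pow (- (d / 2)) * phi f g) (J tau) *
      (J (sig * (sig - fps_X)) * h) = J (fps_const c * sig * P) * g * h"
    unfolding 1 2 by (simp add: mult.assoc)
  show ?thesis
    unfolding 3 commutator_mult_right deriv_ham[OF k] ham_phi[OF fg k kf kh hf] a_def[symmetric]
    unfolding pow_def P_def[symmetric]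
    by (simp add: algebra_simps J_merge) (simp add: J_minus flip: fps_const_neg)
qed

text \<open>Moving \<open>h\<close> past \<open>x\<close> leaves -c (tau / 2) g x. The exponent -c/2
  is the one for which the bracket of \<open>phi\<close> with the power of T, given by
  \<open>phi_pow\<close>, cancels this term.\<close>

lemma E_phi:
  assumes fg: "raise f g" and x: "\<And>p. commutator x (J p) = 0"
    and xf: "commutator x f = k" and xg: "commutator x g = l" and xh: "commutator h x = J (fps_const c) * x"
  shows "commutator (pow (- (c / 2)) * x) (pow b * phi f g) =
    pow (b - c / 2) * (k + J (fps_const (1 / 2) * tau) * l * h)"
proof -
  note [simp] = commute_rewrite[OF raiseD(2)[OF fg]] commute_rewrite[OF x] commutator_rewrite[OF xf] commutator_rewrite[OF xg] commutator_rewrite[OF xh]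
  define P where "P = pow (- (c / 2))"
  define Q where "Q = pow b"
  define q where "q = fps_const (1 / 2) * tau"
  have PQ: "pow (b - c / 2) = P * Q" "P * Q = Q * P" "P * (Q * t) = Q * (P * t)" for t
    by (simp_all add: P_def Q_def pow_def J_merge mult.commute flip: tau_power_add)
  have x': "x * P = P * x" "x * Q = Q * x"
    by (simp_all add: P_def Q_def pow_def)
  have xphi: "commutator x (phi f g) = k + J q * l * h - J (fps_const c * q) * g * x"
    unfolding phi_def q_def[symmetric] commutator_def
    by (simp add: algebra_simps J_merge)
  have "commutator (phi f g) P = - (J (fps_const (c / 2) * tau) * P * g)"
    unfolding phi_pow[OF fg] P_def by (simp flip: fps_const_neg add: J_minus)
  moreover have "fps_const (c / 2) * tau = fps_const c * q"
    by (simp add: q_def flip: mult.assoc)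
  ultimately have phiP: "commutator (phi f g) P = - (P * (J (fps_const c * q) * g))"
    by (simp add: P_def pow_def J_left_commute mult.assoc)
  have "commutator (P * x) (Q * phi f g) =
    P * (Q * commutator x (phi f g)) - Q * commutator (phi f g) P * x"
    unfolding commutator_mult_left commutator_mult_right commutator_swap[of P "phi f g"]
    using PQ(2) x' by (simp add: commutator_def algebra_simps PQ(3))
  also have "\<dots> = P * Q * (k + J q * l * h)"
    unfolding phiP xphi by (simp add: algebra_simps PQ(2,3))
  finally show ?thesis
    by (simp add: P_def Q_def q_def PQ)
qed

text \<open>$W = TF$ for a generator with $\theta = 1$.\<close>

definition W :: "'r \<Rightarrow> 'r \<Rightarrow> 'r"
  where "W f g = pow (1 / 2) * phi f g"

text \<open>The bracket of the two \<open>phi\<close> leaves the mixed terms g' f - g f'. Bracketing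
  each \<open>phi\<close> with the square root of T yields the opposite terms, together with one
  more multiple of \<open>k * h\<close>.\<close>

lemma W_W:
  assumes f: "raise f g" and f': "raise f' g'"
    and h: "commutator h f = - f" "commutator h f' = - f'" "commutator h g = g" "commutator h g' = g'"
    and ff: "commutator f f' = w" and fg: "commutator f g' = y" "commutator f' g = y'"
    and gg: "commutator g g' = k"
  shows "commutator (W f g) (W f' g') = J tau * (w + J (fps_const (1 / 2) * tau) * (y - y') * h +
    J (fps_const (1 / 4) * (tau * tau)) * k * (h * h + 4 * h))"
proof -
  note J_rules = commutator_rewrite[OF raiseD(1)[OF f]] commutator_rewrite[OF raiseD(1)[OF f']]
    commute_rewrite[OF raiseD(2)[OF f]] commute_rewrite[OF raiseD(2)[OF f']] commutator_rewrite[OF h_J]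
  note h_rules = commutator_rewrite[OF h(1)] commutator_rewrite[OF h(2)] commutator_rewrite[OF h(3)] commutator_rewrite[OF h(4)]
  have ff': "f * (f' * t) = f' * (f * t) + w * t" "f * f' = f' * f + w"
    and fg': "f * (g' * t) = g' * (f * t) + y * t" "f * g' = g' * f + y"
     "f' * (g * t) = g * (f' * t) + y' * t" "f' * g = g * f' + y'"
    and gg': "g * (g' * t) = g' * (g * t) + k * t" "g * g' = g' * g + k" for t
    using commutator_rewrite[OF ff] commutator_rewrite[OF fg(1)] commutator_rewrite[OF fg(2)] commutator_rewrite[OF gg] by blast+
  define q where "q = fps_const (1 / 2) * tau"
  have q': "fps_deriv q = rho * q"
    by (simp add: q_def fps_deriv_tau mult_ac)
  have pp: "commutator (phi f g) (phi f' g') = w + J q * (y - y') * h + J q * (g' * f - g * f')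
    + J (rho * q + q * q + q * (fps_const 2 * fps_X * rho * q)) * k * h + J (q * q) * k * h * h"
    unfolding phi_def q_def[symmetric] commutator_def
    by (simp add: algebra_simps J_merge J_rules h_rules ff' fg' gg' q' J_add)
  define R where "R = pow (1 / 2)"
  have "R * R = pow (1 / 2 + 1 / 2)"
    by (simp only: R_def pow_def tau_power_add J_mult)
  then have RR: "R * R = J tau"
    by (simp add: pow_def)
  have R: "R * J p = J p * R" "R * (J p * t) = J p * (R * t)" for p t
    by (simp_all add: R_def pow_def J_commute J_left_commute)
  have phiR: "commutator (phi f g) R = R * (J q * g)" "commutator (phi f' g') R = R * (J q * g')"
    unfolding R_def phi_pow[OF f] phi_pow[OF f'] q_def by (simp_all add: R[unfolded R_def] mult.assoc)
  have "commutator (R * phi f g) (R * phi f' g') = R * (R * commutator (phi f g) (phi f' g')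
      + commutator (phi f g) R * phi f' g' - commutator (phi f' g') R * phi f g)"
    unfolding commutator_def by (simp add: algebra_simps)
  also have "\<dots> = R * R * (commutator (phi f g) (phi f' g') + J q * (g * phi f' g' - g' * phi f g))"
    unfolding phiR by (simp add: algebra_simps)
  also have "g * phi f' g' - g' * phi f g = g * f' - g' * f + J q * k * h"
    unfolding phi_def q_def[symmetric] by (simp add: algebra_simps J_rules gg')
  also have "commutator (phi f g) (phi f' g') + J q * (g * f' - g' * f + J q * k * h) =
    w + J q * (y - y') * h + J (q * q) * k * h * h +
      J (rho * q + q * q + q * (fps_const 2 * fps_X * rho * q) + q * q) * k * h"
    unfolding pp J_add by (simp add: algebra_simps J_merge)
  \<comment> \<open>Because 1 + 2 X q = 2 sig q, the two summands containing \<open>rho\<close> add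
    up to 2 q^2.\<close>
  also have "rho * q + q * q + q * (fps_const 2 * fps_X * rho * q) + q * q = 4 * (q * q)"
  proof -
    have "tau = 2 * q"
      by (simp add: q_def numeral_fps_const flip: mult.assoc)
    moreover from this have "1 + fps_X * (2 * q) = sig * (2 * q)"
      using one_plus_X_mult_tau by simp
    ultimately show ?thesis
      using sig_mult_rho by (simp add: numeral_fps_const[symmetric]) algebra
  qed
  finally have *: "commutator (R * phi f g) (R * phi f' g') = R * R * (w + J q * (y - y') * h +
      J (q * q) * k * h * h + J (4 * (q * q)) * k * h)" .
  have qq: "fps_const (1 / 4) * (tau * tau) = q * q"
    by (simp add: q_def mult_ac)
  have "J (4 * (q * q)) = 4 * J (q * q)" "k * (4 * h) = 4 * (k * h)" for k
    using J_mult[of 4 "q * q"] mult_of_nat_commute[of 4 k]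
    by (simp_all add: J_numeral flip: mult.assoc)
  then show ?thesis
    unfolding W_def R_def[symmetric] qq q_def[symmetric] *
    by (simp add: RR algebra_simps)
qed

text \<open>
  The case $N = 3$, with \<open>z\<close> the deformation parameter and \<open>w = [f\<^sub>1, f\<^sub>2]\<close>: by \<open>W_W\<close> the second
  argument is the commutator of the two deformed generators.
\<close>

lemma W_nested:
  assumes fg: "raise f g" and z: "\<And>x. x * z = z * (x :: 'r)"
    and wJ: "\<And>p. commutator w (J p) = z * (J (fps_deriv p) * h + J (fps_X * fps_deriv (fps_deriv p)))"
    and h: "commutator h f = - f" "commutator h g = g" "commutator h w = - (2 * w)"
    and fg0: "commutator f g = 0" and wf: "commutator w f = 0" and wg: "commutator w g = z * f"
  shows "commutator (W f g) (J tau * (w + J (fps_const (1 / 2) * tau) * (z * h) * h +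
    J (fps_const (1 / 4) * (tau * tau)) * (z * J fps_X) * (h * h + 4 * h))) = 0"
proof -
  define q where "q = fps_const (1 / 2) * tau"
  have tau: "tau = 2 * q"
    by (simp add: q_def numeral_fps_const flip: mult.assoc)
  have sig: "tau * sig = 1 + 2 * fps_X * q" "q * tau * sig = q + 2 * fps_X * q * q"
    using one_plus_X_mult_tau unfolding tau by algebra+
  \<comment> \<open>In terms of q = tau / 2 these are tau^2 = 1 + 2 X tau, rho tau = 1 + rho X and
    rho^2 sig^2 = 1. All later coefficient identities are reduced modulo them.\<close>
  have rels: "4 * q * q = 1 + 4 * q * fps_X" "2 * rho * q = 1 + rho * fps_X" "rho * rho * (1 + fps_X * fps_X) = 1"
    using sig_mult_sig sig_mult_rho one_plus_X_mult_tau tau_def unfolding tau by algebra+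
  \<comment> \<open>\<open>\<alpha>\<close> and \<open>\<beta>\<close> are the coefficients of h h
    and h in the second factor \<open>Z\<close>. \<open>\<gamma>\<close> and \<open>\<delta>\<close>
    are determined by [Z, R] = R z (\<open>\<gamma>\<close> h + \<open>\<delta>\<close>) for the
    square root R of T.\<close>
  define \<alpha> where "\<alpha> = q + fps_X * q * q"
  define \<beta> where "\<beta> = 4 * fps_X * q * q"
  define \<gamma> where "\<gamma> = q + 2 * fps_X * q * q"
  define \<delta> where "\<delta> = 5 * q * q * fps_X"
  have dq: "fps_deriv q = rho * q"
    by (simp add: q_def fps_deriv_tau mult_ac)
  have d\<alpha>: "fps_deriv \<alpha> = rho * q + q * q + 2 * fps_X * rho * q * q"
    by (simp add: \<alpha>_def dq algebra_simps)
  have d\<beta>: "fps_deriv \<beta> = 4 * q * q + 8 * fps_X * rho * q * q"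
    by (simp add: \<beta>_def dq algebra_simps)
  have d2q: "fps_X * fps_deriv (rho * q) = rho * rho * rho * q - rho * q + fps_X * rho * rho * q"
    using rels(3) by (simp add: fps_deriv_rho dq) algebra
  have DDq: "2 * fps_X * fps_deriv (2 * fps_X * (rho * q)) = 4 * fps_X * rho * rho * q * (rho + fps_X)"
    using rels(3) by (simp add: fps_deriv_rho dq) algebra

  have two_const: "fps_const 2 * p = 2 * p" for p :: "complex fps"
    by (simp add: numeral_fps_const)
  define Z where "Z = w + z * (J \<alpha> * (h * h) + J \<beta> * h)"
  define R where "R = pow (1 / 2)"
  define P where "P = tau_power (1 / 2)"

  note z_rules = z[of "J p" for p] z[of h] z[of f] z[of g] z[of w]
  have z_left: "J p * (z * t) = z * (J p * t)" "h * (z * t) = z * (h * t)" "f * (z * t) = z * (f * t)"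
    "g * (z * t) = z * (g * t)" "w * (z * t) = z * (w * t)" for p t
    by (simp_all add: z_rules flip: mult.assoc)
  note rules = commutator_rewrite[OF raiseD(1)[OF fg]] commute_rewrite[OF raiseD(2)[OF fg]] commutator_rewrite[OF h_J]
    commutator_rewrite[OF h(1)] commutator_rewrite[OF h(2)] commutator_rewrite[OF h(3)] commutator_rewrite[OF wJ]
    commute_rewrite[OF fg0] commute_rewrite[OF wf] commutator_rewrite[OF wg] z_rules z_left
  have two: "x * (2 * y) = 2 * (x * y)" for x y :: 'r
    by (simp add: mult_2 distrib_left)
  let ?D = "\<lambda>p. fps_const 2 * fps_X * fps_deriv p"

  \<comment> \<open>This is the desired bracket [R phi, T Z] stripped of its factor R T, by [phi, T]
    = T T g and the value of [Z, R]. It is expanded in the ordered monomials g h h, g h, f h, f and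
    g w, whose coefficients must all vanish.\<close>
  have "commutator (phi f g) Z + J tau * (g * Z) - z * (J \<gamma> * (h * phi f g)) - z * (J \<delta> * phi f g) =
    z * (J (fps_deriv \<alpha> - fps_deriv q + q * ?D \<alpha> - 2 * \<alpha> * q - 2 * \<alpha> * ?D q + tau * \<alpha> - \<gamma> * q) * (g * (h * h))
     + J (fps_deriv \<beta> - fps_deriv q - fps_X * fps_deriv (fps_deriv q) + q * ?D \<beta> - \<alpha> * q - 2 * \<alpha> * ?D q
        - \<alpha> * ?D (?D q) - \<beta> * q - \<beta> * ?D q + tau * \<beta> - \<gamma> * q - \<gamma> * ?D q - \<delta> * q) * (g * h)
     + J (2 * \<alpha> - q - \<gamma>) * (f * h) + J (\<beta> - \<alpha> + \<gamma> - \<delta>) * f) + J (tau - 2 * q) * (g * w)"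
    (is "_ = z * (J ?c1 * _ + J ?c2 * _ + J ?c3 * _ + J ?c4 * _) + J ?c5 * _")
    unfolding phi_def Z_def q_def[symmetric] commutator_def mult_2 J_diff J_add distrib_right
    by (simp add: algebra_simps J_merge rules two) (simp add: mult_2)
  also have "?c1 = 0"
    unfolding d\<alpha> dq by (simp add: \<alpha>_def \<gamma>_def tau algebra_simps flip: numeral_fps_const)
  also have "?c2 = 0"
    unfolding mult.assoc[of "fps_const 2"] two_const d\<beta> dq
    unfolding DDq d2q \<alpha>_def \<beta>_def \<gamma>_def \<delta>_def tau using rels by algebra
  also have "?c3 = 0"
    by (simp add: \<alpha>_def \<gamma>_def)
  also have "?c4 = 0"
    by (simp add: \<alpha>_def \<beta>_def \<gamma>_def \<delta>_def)
  also have "?c5 = 0"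
    by (simp add: tau)
  finally have main: "commutator (phi f g) Z = z * (J \<gamma> * (h * phi f g)) + z * (J \<delta> * phi f g) - J tau * (g * Z)"
    by (simp add: J_0 algebra_simps)

  have dP: "2 * fps_deriv P = rho * P"
  proof -
    have "fps_deriv P = fps_const (1 / 2) * (rho * P)"
      by (simp add: P_def fps_deriv_tau_power mult.assoc)
    then show ?thesis
      by (simp add: numeral_fps_const flip: mult.assoc)
  qed
  \<comment> \<open>A second derivative of the square root of \<open>tau\<close> is needed because
    \<open>w\<close> acts on series by a second-order operator.\<close>
  have ddP: "4 * fps_deriv (fps_deriv P) = rho * rho * P - 2 * fps_X * rho * rho * rho * P"
  proof -
    have "fps_deriv (2 * fps_deriv P) = fps_deriv (rho * P)"
      by (simp only: dP)
    then have "2 * fps_deriv (fps_deriv P) = rho * fps_deriv P - fps_X * rho ^ 3 * P"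
      by (simp add: fps_deriv_rho)
    then show ?thesis
      using dP by algebra
  qed
  have c6: "fps_deriv P + 2 * \<alpha> * ?D P = \<gamma> * P"
    unfolding mult.assoc[of "fps_const 2"] two_const \<alpha>_def \<gamma>_def using rels dP by algebra
  have c7: "fps_X * fps_deriv (fps_deriv P) + \<alpha> * ?D (?D P) + \<beta> * ?D P = \<delta> * P"
    unfolding mult.assoc[of "fps_const 2"] two_const \<alpha>_def \<beta>_def \<delta>_def
    using rels dP ddP by simp algebra
  have "commutator Z (J P) = z * (J (fps_deriv P + 2 * \<alpha> * ?D P) * h +
     J (fps_X * fps_deriv (fps_deriv P) + \<alpha> * ?D (?D P) + \<beta> * ?D P))"
    unfolding Z_def commutator_def mult_2 J_add distrib_right
    by (simp add: algebra_simps J_merge rules)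
  then have ZR: "commutator Z R = R * (z * (J \<gamma> * h + J \<delta>))"
    unfolding c6 c7 R_def pow_def P_def[symmetric]
    by (simp add: z_left J_merge algebra_simps)
  have "tau * sig * fps_deriv tau = tau * tau"
    unfolding fps_deriv_tau using sig_mult_rho by algebra
  then have phi_tau: "commutator (phi f g) (J tau) = J tau * (J tau * g)"
    by (simp only: phi_J[OF fg] J_merge)
  have R: "R * J p = J p * R" "R * (J p * t) = J p * (R * t)" for p t
    by (simp_all add: R_def pow_def J_commute J_left_commute)
  have "commutator (R * phi f g) (J tau * Z) =
    R * J tau * commutator (phi f g) Z + R * commutator (phi f g) (J tau) * Z - J tau * commutator Z R * phi f g"
    unfolding commutator_def by (simp add: algebra_simps R)
  also have "\<dots> = 0"
    unfolding main ZR phi_tau by (simp add: algebra_simps R z_left)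
  also have Z: "Z = w + J (fps_const (1 / 2) * tau) * (z * h) * h +
    J (fps_const (1 / 4) * (tau * tau)) * (z * J fps_X) * (h * h + 4 * h)"
  proof -
    have "fps_const (1 / 4) * (tau * tau) = q * q"
      by (simp add: q_def mult_ac)
    moreover have "J \<beta> * h = J (fps_X * q * q) * (4 * h)"
      using J_mult[of "fps_X * q * q" 4] by (simp add: \<beta>_def J_numeral mult_ac)
    ultimately show ?thesis
      unfolding Z_def q_def[symmetric] \<alpha>_def
      by (simp add: algebra_simps J_merge J_add z_rules z_left)
  qed
  finally show ?thesis
    by (simp add: W_def R_def)
qed

end

section \<open>Elementary matrices in the enveloping algebra\<close>

text \<open>Since \<open>sl_of_matrix\<close> is specified only on traceless matrices, the rules
  below carry trace hypotheses.\<close>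

definition mat_incl :: "complex^'n::{finite,linorder}^'n::{finite,linorder} \<Rightarrow> 'n::{finite,linorder} sl uea"
  where "mat_incl A = uea_incl (sl_of_matrix A)"

lemma sl_of_matrix_add:
  assumes "trace A = 0" "trace B = 0"
  shows "sl_of_matrix (A + B) = sl_of_matrix A + sl_of_matrix B"
  using assms by (simp add: plus_sl_def sl_of_matrix_inverse)

lemma mat_incl_add: "trace A = 0 \<Longrightarrow> trace B = 0 \<Longrightarrow> mat_incl (A + B) = mat_incl A + mat_incl B"
  by (simp add: mat_incl_def sl_of_matrix_add uea_incl_add)

lemma mat_incl_0: "mat_incl 0 = 0"
  using mat_incl_add[of 0 0] by (simp add: trace_def)

lemma mat_incl_uminus: "trace A = 0 \<Longrightarrow> mat_incl (- A) = - mat_incl A"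
  using mat_incl_add[of A "- A"] by (simp add: trace_def sum_negf mat_incl_0 add_eq_0_iff)

lemma mat_incl_double: "trace A = 0 \<Longrightarrow> mat_incl (2 * A) = 2 * mat_incl A"
  by (simp only: mult_2 mat_incl_add)

lemma commutator_mat_incl:
  assumes "trace A = 0" "trace B = 0"
  shows "commutator (mat_incl A) (mat_incl B) = mat_incl (A ** B - B ** A)"
proof -
  have "bracket (sl_of_matrix A) (sl_of_matrix B) = sl_of_matrix (A ** B - B ** A)"
    using assms by (simp add: bracket_sl_def sl_of_matrix_inverse)
  then show ?thesis
    by (simp add: mat_incl_def flip: uea_incl_bracket)
qed

lemma idx_eq_iff:
  assumes "j \<in> {1..CARD('n)}" "k \<in> {1..CARD('n)}"
  shows "(idx j :: 'n::{finite,linorder}) = idx k \<longleftrightarrow> j = k"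
  using assms bij_betw_idx[where 'n = 'n] by (metis bij_betw_imp_inj_on inj_on_contraD)

lemma elem_matrix_mult:
  assumes "j \<in> {1..CARD('n)}" "k \<in> {1..CARD('n)}"
  shows "elem_matrix i j ** elem_matrix k l =
    (if j = k then elem_matrix i l else 0 :: complex^'n::{finite,linorder}^'n::{finite,linorder})"
proof -
  have "(\<Sum>c\<in>(UNIV :: 'n set). (if a = idx i \<and> c = idx j then 1 else 0) * (if c = idx k \<and> b = idx l then 1 else 0)) =
    (if j = k \<and> a = idx i \<and> b = idx l then 1 else 0 :: complex)" for a b :: 'n
  proof -
    have "(if a = idx i \<and> c = idx j then 1 else 0) * (if c = idx k \<and> b = idx l then 1 else 0) =
       (if c = idx j then if j = k \<and> a = idx i \<and> b = idx l then 1 else 0 else 0 :: complex)" for c :: 'n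
      using idx_eq_iff[OF assms] by auto
    note * = this
    show ?thesis
      by (simp only: * sum.delta finite) simp
  qed
  then show ?thesis
    by (auto simp: vec_eq_iff matrix_matrix_mult_def elem_matrix_def)
qed

definition unit_gen :: "nat \<Rightarrow> nat \<Rightarrow> 'n::{finite,linorder} sl uea"
  where "unit_gen i j = mat_incl (elem_matrix i j)"

text \<open>Two arbitrary positions are allowed because the sum of all h_i is E_11 - E_NN and
  [E_ij, E_ji] is E_ii - E_jj.\<close>

definition diag_gen :: "nat \<Rightarrow> nat \<Rightarrow> 'n::{finite,linorder} sl uea"
  where "diag_gen i j = mat_incl (elem_matrix i i - elem_matrix j j)"

lemma matrix_diff_mult:
  "(A - B) ** C = A ** C - B ** (C :: complex^'n::finite^'n::finite)"
  "C ** (A - B) = C ** A - C ** B"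
  by (simp_all add: vec_eq_iff matrix_matrix_mult_def sum_subtractf algebra_simps)

lemma trace_0_mat [simp]: "trace (0 :: complex^'n::finite^'n) = 0"
  by (simp add: trace_def)

lemma commutator_unit_unit:
  assumes "{i, j, k, l} \<subseteq> {1..CARD('n::{finite,linorder})}" "i \<noteq> j" "k \<noteq> l"
  shows "commutator (unit_gen i j) (unit_gen k l) =
    (if j = k then if i = l then diag_gen i j else unit_gen i l
     else if i = l then - unit_gen k j else (0 :: 'n sl uea))"
proof -
  have *: "elem_matrix i j ** elem_matrix k l = (if j = k then elem_matrix i l else 0 :: ((complex, 'n) vec, 'n) vec)"
    "elem_matrix k l ** elem_matrix i j = (if i = l then elem_matrix k j else 0 :: ((complex, 'n) vec, 'n) vec)"
    using assms by (auto simp: elem_matrix_mult)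
  show ?thesis
    using assms
    by (auto simp: unit_gen_def diag_gen_def commutator_mat_incl trace_elem_matrix * mat_incl_0
       mat_incl_uminus)
qed

lemma commutator_diag_unit:
  assumes "{a, b, i, j} \<subseteq> {1..CARD('n::{finite,linorder})}" "i \<noteq> j"
  shows "commutator (diag_gen a b) (unit_gen i j) =
    (of_bool (a = i) - of_bool (a = j) - of_bool (b = i) + of_bool (b = j)) * (unit_gen i j :: 'n sl uea)"
proof -
  let ?A = "elem_matrix i j :: ((complex, 'n) vec, 'n) vec"
  have *: "elem_matrix c c ** ?A = (if c = i then ?A else 0)" "?A ** elem_matrix c c = (if c = j then ?A else 0)"
    if "c \<in> {1..CARD('n)}" for c
    using assms that by (auto simp: elem_matrix_mult)
  have A: "trace ?A = 0"
    using assms by (auto simp: trace_elem_matrix)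
  then have "trace (2 * ?A) = 0"
    by (simp only: mult_2 trace_add) simp
  with A show ?thesis
    using assms
    by (auto simp: unit_gen_def diag_gen_def commutator_mat_incl trace_elem_matrix trace_sub matrix_diff_mult *
      mat_incl_0 mat_incl_uminus mat_incl_double)
qed

lemma commutator_diag_diag:
  assumes "{a, b, i, j} \<subseteq> {1..CARD('n::{finite,linorder})}"
  shows "commutator (diag_gen a b) (diag_gen i j) = (0 :: 'n sl uea)"
proof -
  have *: "elem_matrix c c ** elem_matrix d d = elem_matrix d d ** (elem_matrix c c :: ((complex, 'n) vec, 'n) vec)"
    if "c \<in> {1..CARD('n)}" "d \<in> {1..CARD('n)}" for c d
    using that by (simp add: elem_matrix_mult)
  show ?thesis
    using assms
    by (simp add: diag_gen_def commutator_mat_incl trace_elem_matrix trace_sub matrix_diff_mult mat_incl_0 *)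
qed

lemma diag_gen_add:
  assumes "{a, b, c} \<subseteq> {1..CARD('n::{finite,linorder})}"
  shows "diag_gen a b + diag_gen b c = (diag_gen a c :: 'n sl uea)"
  using assms by (simp add: diag_gen_def trace_elem_matrix trace_sub flip: mat_incl_add)

lemma chev_unit_gen:
  "chev_e i = unit_gen i (Suc i)" "chev_f i = unit_gen (Suc i) i" "chev_h i = diag_gen i (Suc i)"
  by (simp_all add: chev_e_def chev_f_def chev_h_def unit_gen_def diag_gen_def mat_incl_def)

text \<open>The sum telescopes.\<close>

lemma h_sum_eq:
  assumes "CARD('n::{finite,linorder}) \<ge> 2"
  shows "h_sum = (diag_gen 1 CARD('n) :: 'n sl uea)"
proof -
  have "(\<Sum>i = 1..k. chev_h i) = (diag_gen 1 (Suc k) :: 'n sl uea)" if "1 \<le> k" "k < CARD('n)" for k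
    using that
  proof (induction k rule: nat_induct_at_least)
    case (Suc k)
    then show ?case
      by (simp add: chev_unit_gen diag_gen_add)
  qed (simp add: chev_unit_gen)
  from this[of "CARD('n) - 1"] show ?thesis
    using assms by (simp add: h_sum_def)
qed

text \<open>Downward induction on the first index of the nested bracket, with [E_(k,k+1), E_(k+1,N)]
  = E_(k,N).\<close>

lemma e1N_eq:
  assumes "CARD('n::{finite,linorder}) \<ge> 2"
  shows "e1N = (unit_gen 1 CARD('n) :: 'n sl uea)"
proof -
  let ?N = "CARD('n)"
  have "foldr (\<lambda>i. commutator (chev_e i)) [k..<?N - 1] (chev_e (?N - 1)) = (unit_gen k ?N :: 'n sl uea)"
    if "k \<le> ?N - 1" "1 \<le> k" for k
    using that
  proof (induction k rule: inc_induct)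
    case (step k)
    have "commutator (unit_gen k (Suc k)) (unit_gen (Suc k) ?N) = (unit_gen k ?N :: 'n sl uea)"
      using step.hyps step.prems by (subst commutator_unit_unit) auto
    then show ?case
      using step by (simp add: upt_conv_Cons chev_unit_gen)
  qed (use assms in \<open>simp add: chev_unit_gen\<close>)
  from this[of 1] show ?thesis
    using assms by (simp add: e1N_def)
qed

context
  fixes i :: nat
  assumes N: "CARD('n::{finite,linorder}) \<ge> 3" and i: "1 \<le> i" "i < CARD('n)"
begin

lemma commutator_h_e1N:
  "commutator (chev_h i) e1N = of_nat (theta CARD('n) i) * (e1N :: 'n sl uea)"
  using N i by (auto simp: e1N_eq chev_unit_gen commutator_diag_unit theta_def)

lemma commutator_h_sum_e: "commutator h_sum (chev_e i) = of_nat (theta CARD('n) i) * (chev_e i :: 'n sl uea)"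
  using N i by (auto simp: h_sum_eq chev_unit_gen commutator_diag_unit theta_def)

lemma commutator_h_sum_f: "commutator h_sum (chev_f i) = - of_nat (theta CARD('n) i) * (chev_f i :: 'n sl uea)"
  using N i by (auto simp: h_sum_eq chev_unit_gen commutator_diag_unit theta_def)

lemma commutator_h_h_sum: "commutator (chev_h i) h_sum = (0 :: 'n sl uea)"
  "commutator h_sum (chev_h i) = (0 :: 'n sl uea)"
  using N i by (simp_all add: h_sum_eq chev_unit_gen commutator_diag_diag)

lemma commutator_e_e1N: "commutator (chev_e i) e1N = (0 :: 'n sl uea)"
  using N i by (auto simp: e1N_eq chev_unit_gen commutator_unit_unit)

lemma commutator_f_e1N: "commutator (chev_f i) e1N =
  (if i = 1 then unit_gen 2 CARD('n) else if i = CARD('n) - 1 then - unit_gen 1 i else 0 :: 'n sl uea)"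
  using N i by (auto simp: e1N_eq chev_unit_gen commutator_unit_unit numeral_2_eq_2)

end

lemma commutator_h_sum_e1N:
  assumes "CARD('n::{finite,linorder}) \<ge> 2"
  shows "commutator h_sum e1N = 2 * (e1N :: 'n sl uea)"
  using assms by (simp add: e1N_eq h_sum_eq commutator_diag_unit)

context
  fixes i j :: nat
  assumes i: "1 \<le> i" "i < CARD('n::{finite,linorder})" and j: "1 \<le> j" "j < CARD('n)"
begin

lemma commutator_h_h: "commutator (chev_h i) (chev_h j) = (0 :: 'n sl uea)"
  using i j by (simp add: chev_unit_gen commutator_diag_diag)

lemma commutator_h_e: "commutator (chev_h i) (chev_e j) = of_int (cartan i j) * (chev_e j :: 'n sl uea)"
  using i j by (auto simp: chev_unit_gen commutator_diag_unit cartan_def)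

lemma commutator_h_f: "commutator (chev_h i) (chev_f j) = - of_int (cartan i j) * (chev_f j :: 'n sl uea)"
  using i j by (auto simp: chev_unit_gen commutator_diag_unit cartan_def)

lemma commutator_e_f: "commutator (chev_e i) (chev_f j) = (if i = j then chev_h i else (0 :: 'n sl uea))"
  using i j by (auto simp: chev_unit_gen commutator_unit_unit)

lemma serre_e:
  assumes "i \<noteq> j"
  shows "(commutator (chev_e i) ^^ nat (1 - cartan i j)) (chev_e j) = (0 :: 'n sl uea)"
  using assms i j
  by (auto simp: chev_unit_gen commutator_unit_unit cartan_def commutator_zero commutator_uminus nat_add_distrib numeral_2_eq_2)

lemma serre_f:
  assumes "i \<noteq> j"
  shows "(commutator (chev_f i) ^^ nat (1 - cartan i j)) (chev_f j) = (0 :: 'n sl uea)"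
  using assms i j
  by (auto simp: chev_unit_gen commutator_unit_unit cartan_def commutator_zero commutator_uminus nat_add_distrib numeral_2_eq_2)

end

section \<open>Power series in \<open>hh e\<close>\<close>

text \<open>This is p(hh x): the n-th power of \<open>hh * x\<close> has the single coefficient
  \<open>x ^ n\<close>, in degree n. The coefficientwise form reduces brackets with such a value to
  brackets with powers of \<open>x\<close>.\<close>

definition eval_series :: "'g::complex_lie_algebra uea \<Rightarrow> complex fps \<Rightarrow> 'g uea fps"
  where "eval_series x p = Abs_fps (\<lambda>n. uea_const (fps_nth p n) * x ^ n)"

lemma eval_series_nth [simp]: "fps_nth (eval_series x p) n = uea_const (fps_nth p n) * x ^ n"
  by (simp add: eval_series_def)

lemma uea_const_sum: "uea_const (sum f S) = (\<Sum>k\<in>S. uea_const (f k) :: 'g::complex_lie_algebra uea)"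
  by (induction S rule: infinite_finite_induct) (simp_all add: uea_const_0 uea_const_add)

lemma uea_const_uminus: "uea_const (- c) = - uea_const c"
  using uea_const_add[of c "- c"] by (simp add: uea_const_0 add_eq_0_iff)

lemma uea_const_of_nat: "uea_const (of_nat n) = of_nat n"
  by (induction n) (simp_all add: uea_const_0 uea_const_1 uea_const_add)

lemma eval_series_add: "eval_series x (p + q) = eval_series x p + eval_series x q"
  by (rule fps_ext) (simp add: uea_const_add distrib_right)

lemma eval_series_mult: "eval_series x (p * q) = eval_series x p * eval_series x q"
proof (rule fps_ext)
  fix n
  have "uea_const a * x ^ k * (uea_const b * x ^ (n - k)) = uea_const (a * b) * x ^ n" if "k \<le> n" for a b k
  proof -
    have "uea_const a * x ^ k * (uea_const b * x ^ (n - k)) = uea_const a * uea_const b * (x ^ k * x ^ (n - k))"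
      using uea_const_left_commute[of "x ^ k" b "x ^ (n - k)"] by (simp add: mult.assoc)
    then show ?thesis
      using that by (simp add: uea_const_mult flip: power_add)
  qed
  then show "fps_nth (eval_series x (p * q)) n = fps_nth (eval_series x p * eval_series x q) n"
    by (simp add: fps_mult_nth uea_const_sum sum_distrib_right)
qed

lemma eval_series_1: "eval_series x 1 = 1"
  by (rule fps_ext) (simp add: uea_const_1 uea_const_0)

lemma eval_series_power: "eval_series x (p ^ n) = eval_series x p ^ n"
  by (induction n) (simp_all add: eval_series_1 eval_series_mult)

lemma eval_series_const: "eval_series x (fps_const c) = cst c"
  by (rule fps_ext) (simp add: uea_const_0)

lemma eval_series_X: "eval_series x fps_X = hh * fps_const x"
proof (rule fps_ext)
  show "fps_nth (eval_series x fps_X) n = fps_nth (hh * fps_const x) n" for n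
    by (cases n) (simp_all add: uea_const_0 uea_const_1 fps_X_def)
qed

lemma eval_series_minus_1: "eval_series x p - 1 = eval_series x (p - 1)"
  using eval_series_add[of x "p - 1" 1] by (simp add: eval_series_1)

text \<open>In each degree both sides are the same finite sum over powers of p - 1, as evaluation
  respects powers.\<close>

lemma bin_power_eval_series: "bin_power (eval_series x p) c = eval_series x (fps_binomial c oo (p - 1))"
  by (rule fps_ext)
    (simp add: bin_power_nth eval_series_minus_1 fps_compose_nth uea_const_sum uea_const_mult
      sum_distrib_right mult.assoc flip: eval_series_power)

lemma fps_X_left_commute: "a * (fps_X * b) = fps_X * (a * (b :: 'r::ring_1 fps))"
  using fps_mult_fps_X_commute[of a] by (simp flip: mult.assoc)

lemma of_nat_left_commute: "x * (of_nat n * y) = of_nat n * (x * (y :: 'r::ring_1))"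
  using mult_of_nat_commute[of n x] by (simp flip: mult.assoc)

text \<open>The Leibniz rule. At n = 0 the truncated exponent n - 1 is harmless because of the
  factor \<open>of_nat n\<close>.\<close>

lemma commutator_power:
  assumes "y * e = e * (y :: 'r::ring_1)" "commutator x e = y"
  shows "commutator x (e ^ n) = of_nat n * (e ^ (n - 1) * y)"
proof (induction n)
  case (Suc n)
  have "commutator x (e ^ Suc n) = y * e ^ n + e * commutator x (e ^ n)"
    by (simp add: commutator_mult_right assms(2))
  also have "y * e ^ n = e ^ n * y"
    using assms(1) by (intro power_commuting_commutes[symmetric]) simp
  also have "e * commutator x (e ^ n) = of_nat n * (e ^ n * y)"
    unfolding Suc by (cases n) (simp_all add: of_nat_left_commute mult.assoc del: of_nat_Suc)
  finally show ?case
    by (simp add: algebra_simps)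
qed (simp add: commutator_def)

lemma commutator_const_series_nth: "fps_nth (commutator (fps_const x) (eval_series e p)) n =
  uea_const (fps_nth p n) * commutator x (e ^ n)"
  by (simp add: commutator_def algebra_simps uea_const_left_commute)

text \<open>The bracket with p_n e^n is n p_n e^(n-1) y, a coefficient of p' in degree n - 1; the
  factor \<open>hh\<close> moves it back to degree n.\<close>

lemma commutator_series:
  assumes "y * e = e * y" "commutator x e = y"
  shows "commutator (fps_const x) (eval_series e p) = eval_series e (fps_deriv p) * (hh * fps_const y)"
proof (rule fps_ext)
  show "fps_nth (commutator (fps_const x) (eval_series e p)) n =
    fps_nth (eval_series e (fps_deriv p) * (hh * fps_const y)) n" for n
    unfolding fps_X_left_commute
    by (cases n) (simp_all add: commutator_const_series_nth commutator_power[OF assms]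
       uea_const_mult uea_const_of_nat mult.assoc of_nat_left_commute commutator_one_right del: of_nat_Suc power_Suc)
qed

text \<open>For y = c e the trailing factor \<open>hh * y\<close> is the value of c X and merges
  into the series.\<close>

lemma commutator_series_weight:
  assumes "commutator k e = uea_const c * e"
  shows "commutator (fps_const k) (eval_series e p) = eval_series e (fps_const c * fps_X * fps_deriv p)"
proof -
  have "hh * fps_const (uea_const c * e) = cst c * (hh * fps_const e)"
    by (simp only: fps_X_left_commute fps_const_mult[symmetric])
  also have "\<dots> = eval_series e (fps_const c * fps_X)"
    by (simp add: eval_series_const eval_series_mult eval_series_X)
  finally have "commutator (fps_const k) (eval_series e p) =
    eval_series e (fps_deriv p) * eval_series e (fps_const c * fps_X)"
    using commutator_series[OF _ assms] by (simp add: mult.assoc uea_const_left_commute)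
  then show ?thesis
    by (simp add: mult_ac flip: eval_series_mult)
qed

text \<open>Here [w, e] = h does not commute with e. Collecting the h's on the right gives [w, e^n]
  = n e^(n-1) h + n (n-1) e^(n-1), and the second summand is the source of the second
  derivative.\<close>

lemma commutator_series_sl2:
  assumes "commutator w e = h" "commutator h e = 2 * e"
  shows "commutator (fps_const w) (eval_series e p) = hh * (eval_series e (fps_deriv p) * fps_const h +
    eval_series e (fps_X * fps_deriv (fps_deriv p)))"
proof (rule fps_ext)
  have *: "commutator w (e ^ n) = of_nat n * (e ^ (n - 1) * h) + of_nat (n * (n - 1)) * e ^ (n - 1)" for n
  proof (induction n)
    case (Suc n)
    have "commutator w (e ^ Suc n) = h * e ^ n + e * commutator w (e ^ n)"
      by (simp add: commutator_mult_right assms(1))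
    also have "h * e ^ n = e ^ n * h + commutator h (e ^ n)"
      by (simp add: commutator_def)
    also have "commutator h (e ^ n) = of_nat (2 * n) * e ^ n"
    proof -
      have 2: "commutator h e = of_nat 2 * e"
        using assms(2) by simp
      have "commutator h (e ^ n) = of_nat n * (e ^ (n - 1) * (of_nat 2 * e))"
        by (rule commutator_power[OF _ 2]) (simp only: of_nat_left_commute mult.assoc)
      also have "e ^ (n - 1) * (of_nat 2 * e) = of_nat 2 * (e ^ (n - 1) * e)"
        by (rule of_nat_left_commute)
      also have "of_nat n * (of_nat 2 * (e ^ (n - 1) * e)) = of_nat n * (of_nat 2 * e ^ n)"
        by (cases n) (simp_all only: of_nat_0 mult_zero_left power_Suc2 diff_Suc_1)
      also have "\<dots> = of_nat (2 * n) * e ^ n"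
        by (simp only: of_nat_mult mult.commute[of 2 n] mult.assoc)
      finally show ?thesis .
    qed
    also have "e * commutator w (e ^ n) = of_nat n * (e ^ n * h) + of_nat (n * (n - 1)) * e ^ n"
      unfolding Suc distrib_left of_nat_left_commute[of e]
      by (cases n) (simp_all add: mult.assoc del: of_nat_Suc of_nat_mult mult_Suc mult_Suc_right)
    finally have "commutator w (e ^ Suc n) = of_nat (1 + n) * (e ^ n * h) + of_nat (2 * n + n * (n - 1)) * e ^ n"
      by (simp only: of_nat_add distrib_right of_nat_1 mult_1_left add_ac)
    moreover have "2 * n + n * (n - 1) = Suc n * n"
      by (cases n) simp_all
    ultimately show ?case
      by (simp only: plus_1_eq_Suc diff_Suc_1)
  qed (simp add: commutator_def)
  have const: "uea_const a * (of_nat k * t) = uea_const (of_nat k * a) * t" for a k and t :: "'a uea"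
    by (simp add: uea_const_mult uea_const_of_nat mult.assoc of_nat_left_commute)
  show "fps_nth (commutator (fps_const w) (eval_series e p)) n =
    fps_nth (hh * (eval_series e (fps_deriv p) * fps_const h + eval_series e (fps_X * fps_deriv (fps_deriv p)))) n"
    for n
  proof (cases n)
    case (Suc m)
    have X: "fps_nth (fps_X * fps_deriv (fps_deriv p)) m = of_nat (Suc m * m) * fps_nth p (Suc m)"
      by (cases m) (simp_all del: of_nat_Suc mult_Suc mult_Suc_right)
    have X_nth: "fps_nth (hh * q) (Suc m) = fps_nth q m" for q :: "'a uea fps"
      by simp
    have "fps_nth (commutator (fps_const w) (eval_series e p)) n =
        uea_const (of_nat (Suc m) * fps_nth p (Suc m)) * (e ^ m * h) +
        uea_const (of_nat (Suc m * m) * fps_nth p (Suc m)) * e ^ m"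
      unfolding Suc commutator_const_series_nth * distrib_left const by simp
    then show ?thesis
      unfolding Suc X_nth fps_add_nth eval_series_nth X
      by (simp add: mult.assoc del: of_nat_Suc mult_Suc mult_Suc_right)
  qed (simp add: commutator_const_series_nth commutator_one_right)
qed

section \<open>The relations of the Jordanian deformation\<close>

lemma commutator_fps_const: "commutator (fps_const x) (fps_const y) = fps_const (commutator x y)"
  by (simp add: commutator_def)

lemma fps_const_sum: "fps_const (sum f S) = (\<Sum>i\<in>S. fps_const (f i :: 'r::ring))"
  by (rule fps_ext) (simp add: fps_sum_nth)

lemma commutator_hh: "commutator (fps_const x) (hh * fps_const y) = hh * fps_const (commutator x y)"
  by (simp add: commutator_def fps_X_left_commute algebra_simps flip: fps_const_sub)

section \<open>The deformed generators as values of the abstract constructions\<close>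

lemma jordanian_eval_series:
  assumes "CARD('n::{finite,linorder}) \<ge> 3"
  shows "jordanian (eval_series (e1N :: 'n sl uea)) (fps_const h_sum)"
proof
  have "commutator h_sum e1N = uea_const 2 * (e1N :: 'n sl uea)"
    using assms commutator_h_sum_e1N[where 'n = 'n] uea_const_of_nat[of 2, where 'a = "'n sl"] by simp
  then show "commutator (fps_const h_sum) (eval_series (e1N :: 'n sl uea) p) =
      eval_series e1N (fps_const 2 * fps_X * fps_deriv p)" for p
    by (rule commutator_series_weight)
qed (simp_all add: eval_series_add eval_series_mult eval_series_1)

lemma jsqrt_eq: "jsqrt = (eval_series e1N sig :: 'n::{finite,linorder} sl uea fps)"
proof -
  have "1 + hh ^ 2 * fps_const e1N ^ 2 = eval_series (e1N :: 'n sl uea) (1 + fps_X ^ 2)"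
    by (simp add: eval_series_add eval_series_1 eval_series_mult eval_series_X power2_eq_square
      fps_X_left_commute[of "fps_const e1N"] mult.assoc del: fps_const_mult)
  then show ?thesis
    by (simp add: jsqrt_def bin_power_eval_series sig_def)
qed

lemma eval_series_uminus: "eval_series x (- p) = - eval_series x p"
  by (rule fps_ext) (simp add: uea_const_uminus)

lemma jT_eq: "jT = eval_series e1N tau"
  by (simp add: jT_def jsqrt_eq tau_def eval_series_add eval_series_X)

lemma jTinv_eq: "jTinv = (eval_series e1N (sig - fps_X) :: 'n::{finite,linorder} sl uea fps)"
  using eval_series_add[of "e1N :: 'n sl uea" sig "- fps_X"]
  by (simp add: jTinv_def jsqrt_eq eval_series_uminus eval_series_X)

lemma bin_power_jT: "bin_power jT c = eval_series e1N (tau_power c)"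
  by (simp add: jT_eq bin_power_eval_series tau_power_def)

lemma sum_theta: "N \<ge> 3 \<Longrightarrow> (\<Sum>i = 1..N - 1. theta N i) = 2"
  by (simp add: theta_def sum.distrib)

context
  fixes e :: "'n::{finite,linorder} sl uea"
  assumes N: "CARD('n) \<ge> 3"
  defines "e \<equiv> e1N"
begin

interpretation jordanian "eval_series e" "fps_const h_sum :: 'n sl uea fps"
  unfolding e_def by (rule jordanian_eval_series[OF N])

lemma jH_eq: "jH i = ham (of_nat (theta CARD('n) i)) (fps_const (chev_h i))"
  unfolding jH_def e_def[symmetric] jTinv_eq ham_def
  by (simp add: eval_series_mult eval_series_const eval_series_X mult.assoc)

lemma jE_eq: "jE i = pow (of_nat (theta CARD('n) i) / 2) * fps_const (chev_e i)"
  unfolding jE_def bin_power_jT e_def[symmetric] pow_def ..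

definition chev_g :: "nat \<Rightarrow> 'n sl uea"
  where "chev_g i = commutator (chev_f i) e1N"

lemma jF_eq: "jF i = pow (- (of_nat (theta CARD('n) i) / 2)) * phi (fps_const (chev_f i)) (hh * fps_const (chev_g i))"
  unfolding jF_def bin_power_jT chev_g_def e_def[symmetric] unfolding jT_eq phi_def pow_def e_def[symmetric]
  by (simp add: eval_series_mult eval_series_const fps_X_left_commute mult.assoc del: fps_const_mult)

text \<open>The theta_i sum to 2, so the coefficient of \<open>h_sum\<close> is 1 - X (sig - X) =
  sig (sig - X).\<close>

lemma jH_sum_eq: "jH_sum = eval_series e (sig * (sig - fps_X)) * fps_const h_sum"
proof -
  define q where "q = fps_X * (sig - fps_X)"
  have "jH_sum = (\<Sum>i = 1..CARD('n) - 1. fps_const (chev_h i) -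
      eval_series e (of_nat (theta CARD('n) i)) * (eval_series e (fps_const (1 / 2) * q) * fps_const h_sum))"
    unfolding jH_sum_def jH_eq ham_eq q_def by (simp add: fps_of_nat J_mult mult.assoc)
  also have "\<dots> = (\<Sum>i = 1..CARD('n) - 1. fps_const (chev_h i)) -
     of_nat (\<Sum>i = 1..CARD('n) - 1. theta CARD('n) i) * (eval_series e (fps_const (1 / 2) * q) * fps_const h_sum)"
    by (simp add: sum_subtractf sum_distrib_right J_of_nat)
  also have "\<dots> = fps_const h_sum - eval_series e (2 * (fps_const (1 / 2) * q)) * fps_const h_sum"
    unfolding sum_theta[OF N]
    by (simp add: h_sum_def fps_const_sum J_mult J_numeral mult.assoc)
  also have "2 * (fps_const (1 / 2) * q) = q"
    by (simp add: numeral_fps_const flip: mult.assoc)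
  also have "fps_const h_sum - eval_series e q * fps_const h_sum = eval_series e (1 - q) * fps_const h_sum"
    by (simp add: J_diff J_1 left_diff_distrib)
  also have "1 - q = sig * (sig - fps_X)"
    using sig_mult_sig by (simp add: q_def algebra_simps power2_eq_square)
  finally show ?thesis .
qed

lemma const_series:
  "eval_series e (fps_const (of_nat m)) = of_nat m" "eval_series e (fps_const (of_int k)) = of_int k"
  by (simp_all add: J_of_nat J_of_int fps_of_nat fps_of_int)

lemma commutator_const_series_eq_0:
  assumes "commutator x e = 0"
  shows "commutator (fps_const x) (eval_series e p) = 0"
  using commutator_series[of 0 e x p] assms by simp

lemma raise_const:
  assumes "commutator (commutator x e) e = 0"
  shows "raise (fps_const x) (hh * fps_const (commutator x e))"
  unfolding raise_def
proof (intro conjI allI)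
  show "commutator (fps_const x) (eval_series e p) =
      eval_series e (fps_deriv p) * (hh * fps_const (commutator x e))" for p
    using assms by (intro commutator_series) (simp_all add: commutator_def)
  show "commutator (hh * fps_const (commutator x e)) (eval_series e p) = 0" for p
    using commutator_const_series_eq_0[OF assms, of p]
    by (simp add: commutator_def fps_X_left_commute mult.assoc flip: right_diff_distrib)
qed

lemma uea_const_of_int: "uea_const (of_int k) = of_int k"
  by (cases k rule: int_cases2) (simp_all add: uea_const_of_nat uea_const_uminus)

lemma lift_weight:
  assumes "commutator x y = uea_const c * y"
  shows "commutator (fps_const x) (fps_const y) = eval_series e (fps_const c) * fps_const y"
    and "commutator (fps_const x) (hh * fps_const y) = eval_series e (fps_const c) * (hh * fps_const y)"
  using assms by (simp_all add: commutator_fps_const commutator_hh eval_series_const fps_X_left_commute)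

lemma commutator_const_left: "commutator (uea_const c * x) y = uea_const c * commutator x (y :: 'n sl uea)"
  by (simp add: commutator_def right_diff_distrib uea_const_left_commute mult.assoc)

lemma commutator_const_right: "commutator x (uea_const c * y) = uea_const c * commutator x (y :: 'n sl uea)"
  by (simp add: commutator_def right_diff_distrib uea_const_left_commute mult.assoc)

lemma uea_const_diff: "uea_const (c - d) = uea_const c - (uea_const d :: 'n sl uea)"
  using uea_const_add[of c "- d"] by (simp add: uea_const_uminus)

lemma uea_const_numeral: "uea_const (numeral k) = (numeral k :: 'n sl uea)"
  using uea_const_of_nat[of "numeral k", where 'a = "'n sl"] by simp

context
  fixes i assumes i: "i \<in> {1..CARD('n) - 1}"
begin

lemma index_bounds: "1 \<le> i" "i < CARD('n)"
  using i N by auto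

text \<open>The bracket [f_i, e] is E_(2,N), -E_(1,N-1) or 0, each commuting with E_(1,N) because N
  is at least 3; for N = 2 it would be -h_1.\<close>

lemma commutator_g_e: "commutator (chev_g i) e = 0"
  unfolding chev_g_def e_def commutator_f_e1N[OF N index_bounds]
  using N index_bounds by (auto simp: e1N_eq commutator_unit_unit commutator_zero commutator_uminus numeral_2_eq_2)

lemma raise_f: "raise (fps_const (chev_f i)) (hh * fps_const (chev_g i))"
  using raise_const[of "chev_f i"] commutator_g_e by (simp add: chev_g_def e_def)

lemma h_series: "commutator (fps_const (chev_h i)) (eval_series e p) =
  eval_series e (fps_const (of_nat (theta CARD('n) i)) * fps_X * fps_deriv p)"
  by (rule commutator_series_weight) (simp add: e_def commutator_h_e1N[OF N index_bounds] uea_const_of_nat)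

lemma commutator_h_sum_g: "commutator h_sum (chev_g i) = uea_const (2 - of_nat (theta CARD('n) i)) * chev_g i"
proof -
  have "commutator h_sum e1N = uea_const 2 * (e1N :: 'n sl uea)"
    using N by (simp add: commutator_h_sum_e1N uea_const_numeral)
  moreover have "commutator h_sum (chev_f i) = uea_const (- of_nat (theta CARD('n) i)) * (chev_f i :: 'n sl uea)"
    unfolding commutator_h_sum_f[OF N index_bounds] by (simp add: uea_const_of_nat uea_const_uminus)
  ultimately show ?thesis
    unfolding chev_g_def commutator_jacobi[of h_sum]
    by (simp add: commutator_const_left commutator_const_right commutator_uminus uea_const_diff uea_const_uminus algebra_simps)
qed

lemma h_sum_weights:
  "commutator (fps_const h_sum) (fps_const (chev_f i)) =
    - eval_series e (fps_const (of_nat (theta CARD('n) i))) * fps_const (chev_f i)"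
  "commutator (fps_const h_sum) (hh * fps_const (chev_g i)) =
    eval_series e (fps_const (2 - of_nat (theta CARD('n) i))) * (hh * fps_const (chev_g i))"
proof -
  have "commutator h_sum (chev_f i) = uea_const (- of_nat (theta CARD('n) i)) * (chev_f i :: 'n sl uea)"
    unfolding commutator_h_sum_f[OF N index_bounds] by (simp add: uea_const_of_nat uea_const_uminus)
  from lift_weight(1)[OF this] show "commutator (fps_const h_sum) (fps_const (chev_f i)) =
    - eval_series e (fps_const (of_nat (theta CARD('n) i))) * fps_const (chev_f i)"
    by (simp add: J_minus flip: fps_const_neg)
qed (rule lift_weight[OF commutator_h_sum_g])

end

section \<open>The relations that involve an H, and those between E and F\<close>

context
  fixes i j assumes i: "i \<in> {1..CARD('n) - 1}" and j: "j \<in> {1..CARD('n) - 1}"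
begin

lemma commutator_h_g:
  "commutator (chev_h i) (chev_g j) = uea_const (of_nat (theta CARD('n) i) - of_int (cartan i j)) * chev_g j"
proof -
  have "commutator (chev_h i) e1N = uea_const (of_nat (theta CARD('n) i)) * (e1N :: 'n sl uea)"
    using commutator_h_e1N[OF N index_bounds[OF i]] by (simp add: uea_const_of_nat)
  moreover have "commutator (chev_h i) (chev_f j) = uea_const (- of_int (cartan i j)) * (chev_f j :: 'n sl uea)"
    unfolding commutator_h_f[OF index_bounds[OF i] index_bounds[OF j]] by (simp add: uea_const_of_int uea_const_uminus)
  ultimately show ?thesis
    unfolding chev_g_def commutator_jacobi[of "chev_h i"]
    by (simp add: commutator_const_left commutator_const_right commutator_uminus uea_const_diff uea_const_uminus algebra_simps)
qed

lemma jH_jH: "commutator (jH i) (jH j) = (0 :: 'n sl uea fps)"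
  unfolding jH_eq
proof (rule ham_ham[OF _ _ _ h_series[OF i] h_series[OF j]])
  show "commutator (fps_const (chev_h i)) (fps_const (chev_h j)) = (0 :: 'n sl uea fps)"
    by (simp add: commutator_fps_const commutator_h_h[OF index_bounds[OF i] index_bounds[OF j]])
qed (simp_all add: commutator_fps_const commutator_h_h_sum[OF N index_bounds[OF i]] commutator_h_h_sum[OF N index_bounds[OF j]])

lemma jH_jE: "commutator (jH i) (jE j) = (of_int (cartan i j) * jE j :: 'n sl uea fps)"
proof -
  have 1: "commutator h_sum (chev_e j) = uea_const (of_nat (theta CARD('n) j)) * (chev_e j :: 'n sl uea)"
    using commutator_h_sum_e[OF N index_bounds[OF j]] by (simp add: uea_const_of_nat)
  have 2: "commutator (chev_h i) (chev_e j) = uea_const (of_int (cartan i j)) * (chev_e j :: 'n sl uea)"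
    using commutator_h_e[OF index_bounds[OF i] index_bounds[OF j]] by (simp add: uea_const_of_int)
  have "commutator (jH i) (jE j) = eval_series e (fps_const (of_int (cartan i j))) * jE j"
    unfolding jH_eq jE_eq
    using ham_E[OF h_series[OF i] lift_weight(1)[OF 1] lift_weight(1)[OF 2]
      commutator_const_series_eq_0[OF commutator_e_e1N[OF N index_bounds[OF j], folded e_def]]] .
  then show ?thesis
    by (simp add: const_series)
qed

lemma jH_jF: "commutator (jH i) (jF j) =
  - of_int (cartan i j) * jF j + of_nat (theta CARD('n) i) * jTinv * commutator (jF j) jT * (jH_sum :: 'n sl uea fps)"
proof -
  have 2: "commutator (chev_h i) (chev_f j) = uea_const (- of_int (cartan i j)) * (chev_f j :: 'n sl uea)"
    unfolding commutator_h_f[OF index_bounds[OF i] index_bounds[OF j]] by (simp add: uea_const_of_int uea_const_uminus)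
  have 3: "commutator (fps_const (chev_h i)) (fps_const (chev_f j)) =
    - eval_series e (fps_const (of_int (cartan i j))) * fps_const (chev_f j)"
    using lift_weight(1)[OF 2] by (simp add: J_minus flip: fps_const_neg)
  have 4: "commutator (fps_const (chev_h i)) (fps_const h_sum) = (0 :: 'n sl uea fps)"
    by (simp add: commutator_fps_const commutator_h_h_sum[OF N index_bounds[OF i]])
  show ?thesis
    unfolding jH_eq jF_eq jT_eq jTinv_eq jH_sum_eq e_def[symmetric]
    using ham_F[OF raise_f[OF j] h_series[OF i] 3 lift_weight(2)[OF commutator_h_g] 4 h_sum_weights[OF j]]
    by (simp add: const_series)
qed

text \<open>Multiplication by T^(-theta) turns the exponent theta/2 of \<open>jE i\<close> into
  -theta/2, the one required by \<open>E_phi\<close>, which reduces the bracket to [e_i, f_j] and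
  [e_i, g_j].\<close>

lemma jE_jF:
  "commutator (jTinv ^ theta CARD('n) i * jE i) (jF j) = (if i = j then 1 else 0) *
    (jTinv ^ theta CARD('n) i * jH i +
      cst (of_nat (theta CARD('n) i) / 2) * (jT - jTinv) * (jH_sum :: 'n sl uea fps))"
proof -
  let ?t = "theta CARD('n) i"
  have t: "?t = 0 \<or> ?t = 1"
    using N by (auto simp: theta_def)
  have p: "jTinv ^ ?t = pow (- of_nat ?t)"
    unfolding jTinv_eq e_def[symmetric] pow_def using t by (auto simp: tau_power_minus_1 J_1)
  have pE: "pow (- of_nat ?t) * jE i = pow (- (of_nat ?t / 2)) * fps_const (chev_e i)"
    unfolding jE_eq by (simp add: pow_def J_merge(2) flip: tau_power_add)
  \<comment> \<open>By the Jacobi identity and [e_i, e] = 0 this is [[e_i, f_j], e], that is,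
    [h_i, e] when i = j.\<close>
  have "commutator (chev_e i) (chev_g j) = (if i = j then uea_const (of_nat ?t) * e else 0)"
    unfolding chev_g_def commutator_jacobi[of "chev_e i"] commutator_e_f[OF index_bounds[OF i] index_bounds[OF j]] e_def
      commutator_e_e1N[OF N index_bounds[OF i]]
    using commutator_h_e1N[OF N index_bounds[OF i]] by (auto simp: commutator_zero uea_const_of_nat)
  then have l: "commutator (fps_const (chev_e i)) (hh * fps_const (chev_g j)) =
      (if i = j then eval_series e (fps_const (of_nat ?t) * fps_X) else 0)"
    by (simp add: commutator_hh J_mult eval_series_const eval_series_X fps_X_left_commute)
  have k: "commutator (fps_const (chev_e i)) (fps_const (chev_f j)) =
      (if i = j then fps_const (chev_h i) else (0 :: 'n sl uea fps))"
    by (simp add: commutator_fps_const commutator_e_f[OF index_bounds[OF i] index_bounds[OF j]])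
  have h: "commutator h_sum (chev_e i) = uea_const (of_nat ?t) * (chev_e i :: 'n sl uea)"
    using commutator_h_sum_e[OF N index_bounds[OF i]] by (simp add: uea_const_of_nat)
  note main = E_phi[OF raise_f[OF j] commutator_const_series_eq_0[OF commutator_e_e1N[OF N index_bounds[OF i], folded e_def]]
      k l lift_weight(1)[OF h], of "- (of_nat (theta CARD('n) j) / 2)"]
  show ?thesis
  proof (cases "i = j")
    case False
    then show ?thesis
      using main unfolding p pE jF_eq by simp
  next
    case True
    have "commutator (jTinv ^ ?t * jE i) (jF j) = pow (- of_nat ?t) *
      (fps_const (chev_h i) + eval_series e (fps_const (1 / 2) * tau * (fps_const (of_nat ?t) * fps_X)) * fps_const h_sum)"
      using main True unfolding p pE jF_eq by (simp add: J_merge)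
    moreover have "jT - jTinv = eval_series e (2 * fps_X)"
      unfolding jT_eq jTinv_eq e_def[symmetric] J_diff[symmetric] by (simp add: tau_def)
    moreover have "pow (- 1) = eval_series e (sig - fps_X)"
      by (simp add: pow_def tau_power_minus_1)
    \<comment> \<open>Comparison of the coefficients of \<open>h_sum\<close> for theta = 1: the
      right side collects (T - T^(-1))/2 times the sum of the H's and the correction inside T^(-1)
      H_i.\<close>
    moreover have "(sig - fps_X) * (fps_const (1 / 2) * tau * fps_X) =
      fps_const (1 / 2) * (2 * fps_X) * (sig * (sig - fps_X)) - (sig - fps_X) * (fps_const (1 / 2) * fps_X * (sig - fps_X))"
      unfolding tau_def by algebra
    ultimately show ?thesis
      using t True unfolding jH_eq ham_def jH_sum_eq p eval_series_const[symmetric, of _ e]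
      by (auto simp: J_1 J_0 distrib_left right_diff_distrib J_merge simp flip: left_diff_distrib J_diff J_add)
  qed
qed

end

text \<open>All series commute with x, y and their iterated brackets, so they can be pulled out. The
  series \<open>r\<close> is left unspecified because the undeformed Serre relation makes the other
  factor vanish.\<close>

lemma jE_iterate:
  assumes x: "commutator x e = 0" and y: "commutator y e = 0"
  shows "\<exists>r. (commutator (pow a * fps_const x) ^^ k) (pow b * fps_const y) =
    eval_series e r * fps_const ((commutator x ^^ k) y)"
proof -
  have ye: "commutator ((commutator x ^^ k) y) e = 0" for k
  proof (induction k)
    case (Suc k)
    then show ?case
      using commutator_jacobi[of x "(commutator x ^^ k) y" e] x by (simp add: commutator_zero)
  qed (simp add: y)
  show ?thesis
  proof (induction k)
    case 0
    then show ?case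
      by (auto simp: pow_def)
  next
    case (Suc k)
    define z where "z = (commutator x ^^ k) y"
    obtain r where r: "(commutator (pow a * fps_const x) ^^ k) (pow b * fps_const y) = eval_series e r * fps_const z"
      using Suc unfolding z_def by blast
    note comm = commute_rewrite[OF commutator_const_series_eq_0[OF x]] commute_rewrite[OF commutator_const_series_eq_0[OF ye[of k, folded z_def]]]
    have "commutator (pow a * fps_const x) (eval_series e r * fps_const z) =
      eval_series e (tau_power a * r) * commutator (fps_const x) (fps_const z)"
      unfolding commutator_def pow_def
      by (simp add: algebra_simps comm J_merge del: fps_const_mult)
    then show ?case
      by (auto simp: r commutator_fps_const z_def)
  qed
qed

lemma jE_serre:
  assumes i: "i \<in> {1..CARD('n) - 1}" and j: "j \<in> {1..CARD('n) - 1}" and "i \<noteq> j"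
  shows "(commutator (jE i) ^^ nat (1 - cartan i j)) (jE j) = (0 :: 'n sl uea fps)"
  using jE_iterate[OF commutator_e_e1N[OF N index_bounds[OF i], folded e_def] commutator_e_e1N[OF N index_bounds[OF j], folded e_def],
     where a = "of_nat (theta CARD('n) i) / 2" and b = "of_nat (theta CARD('n) j) / 2" and k = "nat (1 - cartan i j)"]
  unfolding serre_e[OF index_bounds[OF i] index_bounds[OF j] \<open>i \<noteq> j\<close>] jE_eq by auto

section \<open>Serre relations among the F's\<close>

definition lift_phi :: "'n sl uea \<Rightarrow> 'n sl uea fps"
  where "lift_phi x = phi (fps_const x) (hh * fps_const (commutator x e))"

lemma lift_phi_0: "lift_phi 0 = 0"
  by (simp add: lift_phi_def phi_def commutator_zero)

lemma jT_power_jF: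
  assumes i: "i \<in> {1..CARD('n) - 1}"
  shows "jT ^ theta CARD('n) i * jF i = pow (of_nat (theta CARD('n) i) / 2) * lift_phi (chev_f i)"
proof -
  have t: "theta CARD('n) i = 0 \<or> theta CARD('n) i = 1"
    using N by (auto simp: theta_def)
  have "jT ^ theta CARD('n) i = pow (of_nat (theta CARD('n) i))"
    unfolding jT_eq e_def[symmetric] pow_def using t by (auto simp: J_1)
  then show ?thesis
    unfolding jF_eq lift_phi_def chev_g_def e_def[symmetric]
    by (simp add: pow_def J_merge(2) flip: tau_power_add)
qed

lemma chev_f_theta_0:
  assumes i: "i \<in> {1..CARD('n) - 1}" and t: "theta CARD('n) i = 0"
  shows "commutator (chev_f i) e = 0" "commutator h_sum (chev_f i) = (0 :: 'n sl uea)" "lift_phi (chev_f i) = fps_const (chev_f i)"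
proof -
  have "i \<noteq> 1" "i \<noteq> CARD('n) - 1"
    using t by (auto simp: theta_def split: if_splits)
  then show 0: "commutator (chev_f i) e = 0"
    unfolding e_def commutator_f_e1N[OF N index_bounds[OF i]] by simp
  show "commutator h_sum (chev_f i) = (0 :: 'n sl uea)"
    using commutator_h_sum_f[OF N index_bounds[OF i]] t by simp
  show "lift_phi (chev_f i) = fps_const (chev_f i)"
    unfolding lift_phi_def 0 phi_def by simp
qed

text \<open>Bracketing with x passes every series and \<open>h_sum\<close>, and the Jacobi identity
  gives [x, [y, e]] = [[x, y], e]. Hence iterated brackets with such an x stay inside
  \<open>lift_phi\<close>.\<close>

lemma commutator_lift_phi:
  assumes x: "commutator x e = 0" "commutator h_sum x = 0"
  shows "commutator (fps_const x) (pow b * lift_phi y) = pow b * lift_phi (commutator x y)"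
proof -
  note comm = commute_rewrite[OF commutator_const_series_eq_0[OF x(1)]]
  have "commutator (fps_const x) (fps_const h_sum) = 0"
    using x(2) commutator_swap[of x h_sum] by (simp add: commutator_fps_const)
  note comm = comm commute_rewrite[OF this]
  have J: "commutator (fps_const x) (eval_series e p) = 0" for p
    by (rule commutator_const_series_eq_0[OF x(1)])
  have *: "commutator (commutator x y) e = commutator x (commutator y e)"
    using commutator_jacobi[of x y e] x(1) by (simp add: commutator_zero)
  show ?thesis
    unfolding lift_phi_def phi_def pow_def * commutator_hh[symmetric] commutator_fps_const[symmetric]
    unfolding commutator_def
    by (simp add: algebra_simps comm fps_X_left_commute[of "fps_const x"] del: fps_const_mult)
qed

lemma jF_serre_theta_0:
  assumes i: "i \<in> {1..CARD('n) - 1}" and j: "j \<in> {1..CARD('n) - 1}" and "i \<noteq> j" and t: "theta CARD('n) i = 0"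
  shows "(commutator (jT ^ theta CARD('n) i * jF i) ^^ nat (1 - cartan i j)) (jT ^ theta CARD('n) j * jF j) =
    (0 :: 'n sl uea fps)"
proof -
  have "(commutator (fps_const (chev_f i)) ^^ k) (pow b * lift_phi (chev_f j)) =
    pow b * lift_phi ((commutator (chev_f i) ^^ k) (chev_f j))" for k b
    by (induction k) (simp_all add: commutator_lift_phi chev_f_theta_0[OF i t])
  then have "(commutator (fps_const (chev_f i)) ^^ nat (1 - cartan i j)) (pow b * lift_phi (chev_f j)) = 0" for b
    by (simp only: serre_f[OF index_bounds[OF i] index_bounds[OF j] \<open>i \<noteq> j\<close>] lift_phi_0 mult_zero_right)
  moreover have "pow (of_nat (theta CARD('n) i) / 2) * lift_phi (chev_f i) = fps_const (chev_f i)"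
    unfolding chev_f_theta_0[OF i t] by (simp add: t pow_def J_1)
  ultimately show ?thesis
    unfolding jT_power_jF[OF i] jT_power_jF[OF j] by simp
qed

lemma W_lift:
  "pow (1 / 2) * lift_phi x = W (fps_const x) (hh * fps_const (commutator x e))"
  by (simp add: W_def lift_phi_def)

text \<open>In \<open>W_W\<close> the middle term collapses by [x, [y, e]] - [y, [x, e]] = [[x, y],
  e]. Thus the bracket vanishes as soon as [x, y] and [[x, e], [y, e]] do.\<close>

lemma commutator_lift_lift:
  assumes xe: "commutator (commutator x e) e = 0" and ye: "commutator (commutator y e) e = 0"
    and h: "commutator h_sum x = - x" "commutator h_sum y = - y"
     "commutator h_sum (commutator x e) = commutator x e" "commutator h_sum (commutator y e) = commutator y e"
  shows "commutator (pow (1 / 2) * lift_phi x) (pow (1 / 2) * lift_phi y) = eval_series e tau *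
    (fps_const (commutator x y) + eval_series e (fps_const (1 / 2) * tau) * (hh * fps_const (commutator (commutator x y) e)) * fps_const h_sum +
    eval_series e (fps_const (1 / 4) * (tau * tau)) * (hh * (hh * fps_const (commutator (commutator x e) (commutator y e)))) *
      (fps_const h_sum * fps_const h_sum + 4 * fps_const h_sum))"
proof -
  have 1: "commutator (fps_const h_sum) (fps_const x) = - fps_const x" "commutator (fps_const h_sum) (fps_const y) = - fps_const y"
    "commutator (fps_const h_sum) (hh * fps_const (commutator x e)) = hh * fps_const (commutator x e)"
    "commutator (fps_const h_sum) (hh * fps_const (commutator y e)) = hh * fps_const (commutator y e)"
    by (simp_all add: commutator_fps_const commutator_hh h)
  have 2: "commutator (hh * fps_const (commutator x e)) (hh * fps_const (commutator y e)) =
      hh * (hh * fps_const (commutator (commutator x e) (commutator y e)))"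
    unfolding commutator_mult_left commutator_hh
    by (simp add: commutator_def fps_mult_fps_X_commute)
  have 3: "hh * fps_const (commutator x (commutator y e)) - hh * fps_const (commutator y (commutator x e)) =
      hh * fps_const (commutator (commutator x y) e)"
  proof -
    have "commutator (commutator x y) e = commutator x (commutator y e) - commutator y (commutator x e)"
      by (simp add: commutator_def algebra_simps)
    then show ?thesis
      by (simp add: right_diff_distrib flip: fps_const_sub)
  qed
  show ?thesis
    unfolding W_lift
      W_W[OF raise_const[OF xe] raise_const[OF ye] 1 commutator_fps_const commutator_hh commutator_hh 2] 3 ..
qed

lemma chev_f_theta_1:
  assumes i: "i \<in> {1..CARD('n) - 1}" and t: "theta CARD('n) i = 1"
  shows "commutator (commutator (chev_f i) e) e = 0" "commutator h_sum (chev_f i) = (- chev_f i :: 'n sl uea)"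
    "commutator h_sum (commutator (chev_f i) e) = commutator (chev_f i) e"
  using commutator_g_e[OF i] commutator_h_sum_f[OF N index_bounds[OF i]] commutator_h_sum_g[OF i]
  by (simp_all add: t chev_g_def e_def uea_const_1)

text \<open>The first bracket is minus the deformation of x = [f_j, f_i], by exchanging the
  arguments in \<open>commutator_lift_phi\<close>. The second bracket is then one of two lifted
  elements with theta = 1 weights, and the undeformed Serre relation gives [f_i, x] = 0.\<close>

lemma jF_serre_theta_1_0:
  assumes i: "i \<in> {1..CARD('n) - 1}" and j: "j \<in> {1..CARD('n) - 1}"
    and t: "theta CARD('n) i = 1" "theta CARD('n) j = 0"
  shows "(commutator (jT ^ theta CARD('n) i * jF i) ^^ nat (1 - cartan i j)) (jT ^ theta CARD('n) j * jF j) =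
    (0 :: 'n sl uea fps)"
proof -
  have "i \<noteq> j"
    using t by auto
  define x where "x = commutator (chev_f j) (chev_f i :: 'n sl uea)"
  let ?W = "\<lambda>y. pow (1 / 2) * lift_phi y"
  have W: "jT ^ theta CARD('n) i * jF i = ?W (chev_f i)"
    unfolding jT_power_jF[OF i] by (simp add: t)
  have W': "jT ^ theta CARD('n) j * jF j = (fps_const (chev_f j) :: 'n sl uea fps)"
    unfolding jT_power_jF[OF j] chev_f_theta_0[OF j t(2)] by (simp add: t pow_def J_1)
  have WW: "commutator (?W (chev_f i)) (fps_const (chev_f j)) = - ?W x"
    unfolding commutator_swap[of _ "fps_const (chev_f j)"] x_def
    using chev_f_theta_0[OF j t(2)] by (simp add: commutator_lift_phi)
  note serre = serre_f[OF index_bounds[OF i] index_bounds[OF j] \<open>i \<noteq> j\<close>]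
  have "cartan i j = 0 \<or> cartan i j = - 1"
    using \<open>i \<noteq> j\<close> by (simp add: cartan_def)
  then consider "cartan i j = 0" | "cartan i j = - 1"
    by blast
  then show ?thesis
  proof cases
    case 1
    then have "x = 0"
      using serre commutator_swap[of "chev_f i" "chev_f j :: 'n sl uea"] by (simp add: x_def)
    then show ?thesis
      unfolding W W' using 1 WW by (simp add: lift_phi_0)
  next
    case 2
    have 0: "commutator (chev_f i) x = 0"
      using 2 serre commutator_swap[of "chev_f i" "chev_f j :: 'n sl uea"]
      by (simp add: x_def numeral_2_eq_2 commutator_uminus)
    have fj: "commutator (chev_f j) e = 0" "commutator h_sum (chev_f j) = (0 :: 'n sl uea)"
      using chev_f_theta_0[OF j t(2)] by blast+
    note fi = chev_f_theta_1[OF i t(1)]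
    have xe: "commutator x e = commutator (chev_f j) (commutator (chev_f i) e)"
      using commutator_jacobi[of "chev_f j" "chev_f i" e] fj by (simp add: x_def commutator_zero)
    have xee: "commutator (commutator x e) e = 0"
      using commutator_jacobi[of "chev_f j" "commutator (chev_f i) e" e] fj fi by (simp add: xe commutator_zero)
    have hx: "commutator h_sum x = - x" "commutator h_sum (commutator x e) = commutator x e"
      unfolding xe unfolding x_def
      using commutator_jacobi[of h_sum "chev_f j" "chev_f i :: 'n sl uea"]
        commutator_jacobi[of h_sum "chev_f j" "commutator (chev_f i) e"] fj fi
      by (simp_all add: commutator_zero commutator_uminus)
    have j_inner: "j \<noteq> 1" "j \<noteq> CARD('n) - 1"
      using t(2) by (auto simp: theta_def split: if_splits)
    \<comment> \<open>If j is adjacent to i, these are up to sign E_(2,N) and E_(3,N) for i = 1, and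
      E_(1,N-1) and E_(1,N-2) for i = N - 1.\<close>
    have "commutator (commutator (chev_f i) e) (commutator x e) = 0"
      unfolding xe unfolding e_def commutator_f_e1N[OF N index_bounds[OF i]]
      using N index_bounds[OF i] index_bounds[OF j] j_inner
      by (auto simp: chev_unit_gen commutator_unit_unit commutator_zero commutator_uminus numeral_2_eq_2)
    with commutator_lift_lift[OF fi(1) xee fi(2) hx(1) fi(3) hx(2)] 0
    have "commutator (?W (chev_f i)) (?W x) = 0"
      by (simp add: commutator_zero)
    then show ?thesis
      unfolding W W' using 2 WW by (simp add: numeral_2_eq_2 commutator_uminus)
  qed
qed

text \<open>The indices are 1 and N - 1. For N > 3 both f's commute, and so do E_(2,N) and
  E_(1,N-1), which settles the single bracket. For N = 3 neither holds and a double bracket is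
  needed.\<close>

lemma jF_serre_theta_1_1:
  assumes i: "i \<in> {1..CARD('n) - 1}" and j: "j \<in> {1..CARD('n) - 1}" and "i \<noteq> j"
    and t: "theta CARD('n) i = 1" "theta CARD('n) j = 1"
  shows "(commutator (jT ^ theta CARD('n) i * jF i) ^^ nat (1 - cartan i j)) (jT ^ theta CARD('n) j * jF j) =
    (0 :: 'n sl uea fps)"
proof -
  let ?W = "\<lambda>y. pow (1 / 2) * lift_phi y"
  have W: "jT ^ theta CARD('n) i * jF i = ?W (chev_f i)" "jT ^ theta CARD('n) j * jF j = ?W (chev_f j)"
    unfolding jT_power_jF[OF i] jT_power_jF[OF j] unfolding t of_nat_1 by (rule refl)+
  note fi = chev_f_theta_1[OF i t(1)] and fj = chev_f_theta_1[OF j t(2)]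
  note WW = commutator_lift_lift[OF fi(1) fj(1) fi(2) fj(2) fi(3) fj(3)]
  have "k = 1 \<or> k = CARD('n) - 1" if "theta CARD('n) k = 1" for k
  proof (rule ccontr)
    assume "\<not> ?thesis"
    then have "theta CARD('n) k = 0"
      by (simp add: theta_def)
    then show False
      using that by simp
  qed
  from this[OF t(1)] this[OF t(2)] have ij: "i = 1 \<and> j = CARD('n) - 1 \<or> i = CARD('n) - 1 \<and> j = 1"
    using \<open>i \<noteq> j\<close> by blast
  show ?thesis
  proof (cases "CARD('n) = 3")
    case False
    then have "cartan i j = 0"
      using N ij by (auto simp: cartan_def)
    moreover from this have 0: "commutator (chev_f i) (chev_f j) = (0 :: 'n sl uea)"
      using serre_f[OF index_bounds[OF i] index_bounds[OF j] \<open>i \<noteq> j\<close>] by simp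
    moreover have "commutator (commutator (chev_f i) e) (commutator (chev_f j) e) = 0"
      unfolding e_def commutator_f_e1N[OF N index_bounds[OF i]] commutator_f_e1N[OF N index_bounds[OF j]]
      using N False ij
      by (auto simp: commutator_unit_unit commutator_zero commutator_uminus numeral_2_eq_2)
    ultimately show ?thesis
      unfolding W using WW by (simp add: commutator_zero)
  next
    case True
    let ?f = "\<lambda>k. chev_f k :: 'n sl uea" and ?V = "\<lambda>k. pow (1 / 2) * lift_phi (chev_f k)"
    define w where "w = commutator (?f 1) (?f 2)"
    \<comment> \<open>This specializes \<open>commutator_lift_lift\<close> by [w, e] = h and
      [[f_1, e], [f_2, e]] = e; one of the two factors \<open>hh\<close> joins e to form the value
      of X.\<close>
    define Z where "Z = fps_const w + eval_series e (fps_const (1 / 2) * tau) * (hh * fps_const h_sum) * fps_const h_sum +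
      eval_series e (fps_const (1 / 4) * (tau * tau)) * (hh * eval_series e fps_X) *
      (fps_const h_sum * fps_const h_sum + 4 * fps_const h_sum)"
    have ij: "i = 1 \<and> j = 2 \<or> i = 2 \<and> j = 1"
      using ij True by auto
    have w: "w = - unit_gen 3 1"
      using True by (simp add: w_def chev_unit_gen commutator_unit_unit)
    have e: "e = unit_gen 1 3" and h: "h_sum = (diag_gen 1 3 :: 'n sl uea)"
      using True e1N_eq[where 'n = 'n] h_sum_eq[where 'n = 'n] by (simp_all add: e_def)
    have g: "commutator (?f 1) e = unit_gen 2 3" "commutator (?f 2) e = - unit_gen 1 2"
      using True by (simp_all add: e chev_unit_gen commutator_unit_unit numeral_2_eq_2)
    have "diag_gen 1 3 + diag_gen 3 1 = (diag_gen 1 1 :: 'n sl uea)"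
      using True by (intro diag_gen_add) simp
    then have "- diag_gen 3 1 = (diag_gen 1 3 :: 'n sl uea)"
      by (simp add: diag_gen_def[of "Suc 0" "Suc 0"] mat_incl_0 add_eq_0_iff)
    then have we: "commutator w e = h_sum"
      unfolding w e h using True by (simp add: commutator_unit_unit commutator_uminus)
    have gg: "commutator (commutator (?f 1) e) (commutator (?f 2) e) = e"
      unfolding g using True by (simp add: e commutator_unit_unit commutator_uminus)
    have he: "commutator h_sum e = 2 * e"
      unfolding e_def using N by (intro commutator_h_sum_e1N) simp
    have hw: "commutator h_sum w = - (2 * w)"
      unfolding h w using True by (simp add: commutator_diag_unit commutator_uminus)
    have 12: "1 \<in> {1..CARD('n) - 1}" "2 \<in> {1..CARD('n) - 1}" "theta CARD('n) 1 = 1" "theta CARD('n) 2 = 1"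
      using True by (auto simp: theta_def)
    have VV: "commutator (?V 1) (?V 2) = eval_series e tau * Z"
      using commutator_lift_lift[of "?f 1" "?f 2"] chev_f_theta_1[OF 12(1,3)] chev_f_theta_1[OF 12(2,4)]
      unfolding w_def[symmetric] we gg Z_def eval_series_X by simp
    \<comment> \<open>Exchanging the two generators only changes the sign of the inner bracket, so
      the same \<open>Z\<close> serves both Serre relations.\<close>
    have nested: "commutator (?V k) (eval_series e tau * Z) = 0" if "k \<in> {1, 2}" for k
    proof -
      have k: "k \<in> {1..CARD('n) - 1}" and t: "theta CARD('n) k = 1"
        using that True by (auto simp: theta_def)
      have "commutator (?f k) (commutator (?f k) e) = 0" "commutator w (?f k) = 0"
        "commutator w (commutator (?f k) e) = ?f k"
        unfolding w using that True g
        by (auto simp: chev_unit_gen commutator_unit_unit commutator_uminus numeral_2_eq_2 numeral_3_eq_3)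
      note fs = this chev_f_theta_1[OF k t]
      show ?thesis
        unfolding W_lift Z_def
        by (rule W_nested[OF raise_const[OF fs(4)] fps_mult_fps_X_commute[symmetric] commutator_series_sl2[OF we he]])
          (simp_all add: fs hw mult_2 commutator_fps_const commutator_hh)
    qed
    have "nat (1 - cartan i j) = Suc (Suc 0)"
      using ij by (auto simp: cartan_def)
    moreover have "commutator (?V 2) (?V 1) = - (eval_series e tau * Z)"
      unfolding commutator_swap[of "?V 2"] VV ..
    ultimately show ?thesis
      unfolding W using ij nested VV by (auto simp: commutator_uminus)
  qed
qed

lemma jF_serre:
  assumes i: "i \<in> {1..CARD('n) - 1}" and j: "j \<in> {1..CARD('n) - 1}" and "i \<noteq> j"
  shows "(commutator (jT ^ theta CARD('n) i * jF i) ^^ nat (1 - cartan i j)) (jT ^ theta CARD('n) j * jF j) =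
    (0 :: 'n sl uea fps)"
proof -
  have "theta CARD('n) k = 0 \<or> theta CARD('n) k = 1" for k
    using N by (auto simp: theta_def)
  then consider "theta CARD('n) i = 0" | "theta CARD('n) i = 1" "theta CARD('n) j = 0"
    | "theta CARD('n) i = 1" "theta CARD('n) j = 1"
    by metis
  then show ?thesis
  proof cases
    case 1
    then show ?thesis
      by (rule jF_serre_theta_0[OF i j \<open>i \<noteq> j\<close>])
  next
    case 2
    then show ?thesis
      by (rule jF_serre_theta_1_0[OF i j])
  next
    case 3
    then show ?thesis
      by (rule jF_serre_theta_1_1[OF i j \<open>i \<noteq> j\<close>])
  qed
qed

end

theorem proposition8:
  fixes i j :: nat
  assumes "CARD('n::{finite,linorder}) \<ge> 3"
    and "i \<in> {1..CARD('n) - 1}" and "j \<in> {1..CARD('n) - 1}"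
  defines "\<theta> \<equiv> theta CARD('n)"
  shows "commutator (jH i) (jH j) = (0 :: 'n sl uea fps) \<and>
    commutator (jH i) (jE j) = (of_int (cartan i j) * jE j :: 'n sl uea fps) \<and>
    commutator (jH i) (jF j) =
      (- of_int (cartan i j) * jF j + of_nat (\<theta> i) * jTinv * commutator (jF j) jT * jH_sum
        :: 'n sl uea fps) \<and>
    commutator (jTinv ^ \<theta> i * jE i) (jF j) =
      ((if i = j then 1 else 0) *
        (jTinv ^ \<theta> i * jH i + cst (of_nat (\<theta> i) / 2) * (jT - jTinv) * jH_sum)
        :: 'n sl uea fps) \<and>
    (\<bar>int i - int j\<bar> > 1 \<longrightarrow>
      commutator (jE i) (jE j) = (0 :: 'n sl uea fps) \<and>
      commutator (jT ^ \<theta> i * jF i) (jT ^ \<theta> j * jF j) = (0 :: 'n sl uea fps)) \<and>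
    (i \<noteq> j \<longrightarrow>
      (commutator (jE i) ^^ nat (1 - cartan i j)) (jE j) = (0 :: 'n sl uea fps) \<and>
      (commutator (jT ^ \<theta> i * jF i) ^^ nat (1 - cartan i j)) (jT ^ \<theta> j * jF j) =
        (0 :: 'n sl uea fps))"
proof (intro conjI impI)
  note H = jH_jH[OF assms(1-3)] jH_jE[OF assms(1-3)] jH_jF[OF assms(1-3)] jE_jF[OF assms(1-3)]
  note serre = jE_serre[OF assms(1-3)] jF_serre[OF assms(1-3)]
  show "commutator (jH i) (jH j) = (0 :: 'n sl uea fps)"
    "commutator (jH i) (jE j) = (of_int (cartan i j) * jE j :: 'n sl uea fps)"
    "commutator (jH i) (jF j) =
      (- of_int (cartan i j) * jF j + of_nat (\<theta> i) * jTinv * commutator (jF j) jT * jH_sum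
        :: 'n sl uea fps)"
    "commutator (jTinv ^ \<theta> i * jE i) (jF j) = ((if i = j then 1 else 0) *
      (jTinv ^ \<theta> i * jH i + cst (of_nat (\<theta> i) / 2) * (jT - jTinv) * jH_sum)
      :: 'n sl uea fps)"
    using H by (simp_all only: \<theta>_def)
  show "(commutator (jE i) ^^ nat (1 - cartan i j)) (jE j) = (0 :: 'n sl uea fps)"
    "(commutator (jT ^ \<theta> i * jF i) ^^ nat (1 - cartan i j)) (jT ^ \<theta> j * jF j) =
      (0 :: 'n sl uea fps)" if "i \<noteq> j"
    using serre[OF that] by (simp_all only: \<theta>_def)
  assume "\<bar>int i - int j\<bar> > 1"
  \<comment> \<open>For distant indices a_ij = 0, so the Serre exponent is 1 and the relation is the
    plain commutator.\<close>
  then have "i \<noteq> j" "nat (1 - cartan i j) = Suc 0"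
    by (auto simp: cartan_def)
  with serre show "commutator (jE i) (jE j) = (0 :: 'n sl uea fps)"
    "commutator (jT ^ \<theta> i * jF i) (jT ^ \<theta> j * jF j) = (0 :: 'n sl uea fps)"
    by (simp_all add: \<theta>_def)
qed

end
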